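(* Let $(\phi^n,r^n)_{n\ge0}$ be a solution of the $(2-\alpha)$-order L1-SAV scheme, for $n\ge0$, $$\bar\partial_{n+\frac12}^\alpha\phi=\gamma\,\mathcal G\mu^{n+\frac12},$$ $$\mu^{n+\frac12}=\mathcal L\phi^{n+\frac12}+\frac{r^{n+\frac12}}{\sqrt{E_1(\bar\phi^{n+\frac12})+C_0}}\,\delta_\phi E_1(\bar\phi^{n+\frac12}),$$ $$r^{n+1}-r^n=\frac{1}{2\sqrt{E_1(\bar\phi^{n+\frac12})+C_0}}\left\langle\delta_\phi E_1(\bar\phi^{n+\frac12}),\phi^{n+1}-\phi^n\right\rangle,$$ where $\phi^{n+\frac12}=\frac12(\phi^{n+1}+\phi^n)$, $r^{n+\frac12}=\frac12(r^{n+1}+r^n)$, $\bar\phi^{n+\frac12}=\frac32\phi^n-\frac12\phi^{n-1}$. Let $E^n=\frac12\langle\mathcal L\phi^n,\phi^n\rangle+(r^n)^2$ be the modified energy. Then the energy boundedness $$E^{n+1}\le E^0\qquad\text{for all }n\ge0$$ and the fractional energy law $$\bar\partial_{n+\frac12}^\alpha E=\sum_{k=0}^n\tilde b_{n-k}\,\bar\partial_{k+1}E\le0\qquad\text{for all }n\ge0$$ hold.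
   Context: Let $\alpha\in(0,1)$, $\gamma>0$, $\varepsilon>0$, $\Delta t>0$ the uniform time step, $t_n=n\Delta t$ (indices $n$ run as long as $t_{n+1}\le T$). $\Omega$ is a bounded rectangular box with periodic boundary conditions; $\langle\cdot,\cdot\rangle$ is the $L^2(\Omega)$ inner product. Each $\phi^n$ is a periodic function on $\Omega$, smooth enough that all expressions make sense, each $r^n$ is a real number; $\phi^0$, $r^0$ and the starting value $\phi^{-1}$ (needed only in $\bar\phi^{\frac12}$) are given. $C_0>0$ is a constant such that the quantities under the square roots are positive. Discrete derivatives. For a sequence $(v^n)$ (of functions or of real numbers): $\bar\partial_k v=\frac{v^k-v^{k-1}}{\Delta t}$ for $k\ge1$, and $\bar\partial_{n+\frac12}^\alpha v=\sum_{j=0}^n\tilde b_{n-j}\,\bar\partial_{j+1}v$ for $n\ge0$, where $\tilde b_0=\frac{\Delta t^{1-\alpha}2^{\alpha-1}}{\Gamma(2-\alpha)}$ and $\tilde b_j=\frac{\Delta t^{1-\alpha}}{\Gamma(2-\alpha)}\left[(j+\frac12)^{1-\alpha}-(j-\frac12)^{1-\alpha}\right]$ for $j\ge1$. Models. $\mathcal L$ is a symmetric nonnegative linear operator, $\mathcal G$ a nonpositive one, $E_1$ is the nonquadratic part of the energy and $\delta_\phi E_1$ its $L^2$ variational derivative: (i) Allen--Cahn: $\mathcal G=-1$, $\mathcal L=-\varepsilon^2\Delta$, $E_1(\phi)=\int_\Omega\frac14(1-\phi^2)^2dx$, $\delta_\phi E_1(\phi)=\phi^3-\phi$. (ii) Cahn--Hilliard: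 $\mathcal G=\Delta$ (with inverse on mean-zero functions), $\mathcal L$ and $E_1$ as for Allen--Cahn. (iii) MBE: $\mathcal G=-1$, $\mathcal L=\varepsilon^2\Delta^2$, $E_1(\phi)=\int_\Omega F_{\rm m}(\nabla\phi)\,dx$, $\delta_\phi E_1(\phi)=\nabla\cdot\mathbf f_{\rm m}(\nabla\phi)$, with either $F_{\rm m}(\nabla\phi)=\frac14(1-|\nabla\phi|^2)^2$, $\mathbf f_{\rm m}(\nabla\phi)=\nabla\phi-|\nabla\phi|^2\nabla\phi$ (with slope selection), or $F_{\rm m}(\nabla\phi)=-\frac12\ln(1+|\nabla\phi|^2)$, $\mathbf f_{\rm m}(\nabla\phi)=\frac{\nabla\phi}{1+|\nabla\phi|^2}$ (without slope selection). *)

theory Defs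
  imports "HOL-Analysis.Analysis"
begin

subsection \<open>Periodic functions on a box, and differential operators\<close>

text \<open>
  A periodic function on the box with corners \<open>a\<close>, \<open>b\<close> is represented by its periodic
  extension to the whole space; integrals are taken over \<open>cbox a b\<close>.
\<close>

definition box_periodic :: "'a::euclidean_space \<Rightarrow> 'a \<Rightarrow> ('a \<Rightarrow> real) \<Rightarrow> bool" where
  "box_periodic a b f \<longleftrightarrow> (\<forall>i\<in>Basis. \<forall>x. f (x + ((b - a) \<bullet> i) *\<^sub>R i) = f x)"

definition L2_inner :: "'a::euclidean_space \<Rightarrow> 'a \<Rightarrow> ('a \<Rightarrow> real) \<Rightarrow> ('a \<Rightarrow> real) \<Rightarrow> real" where
  "L2_inner a b f g = integral (cbox a b) (\<lambda>x. f x * g x)"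

definition partial :: "'a::euclidean_space \<Rightarrow> ('a \<Rightarrow> real) \<Rightarrow> 'a \<Rightarrow> real" where
  "partial i f x = frechet_derivative f (at x) i"

primrec C_diff :: "nat \<Rightarrow> ('a::euclidean_space \<Rightarrow> real) \<Rightarrow> bool" where
  "C_diff 0 f \<longleftrightarrow> continuous_on UNIV f"
| "C_diff (Suc k) f \<longleftrightarrow> f differentiable_on UNIV \<and> (\<forall>i\<in>Basis. C_diff k (partial i f))"

definition grad :: "('a::euclidean_space \<Rightarrow> real) \<Rightarrow> 'a \<Rightarrow> 'a" where
  "grad f x = (\<Sum>i\<in>Basis. partial i f x *\<^sub>R i)"

definition dvg :: "('a::euclidean_space \<Rightarrow> 'a) \<Rightarrow> 'a \<Rightarrow> real" where
  "dvg V x = (\<Sum>i\<in>Basis. partial i (\<lambda>y. V y \<bullet> i) x)"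

definition laplacian :: "('a::euclidean_space \<Rightarrow> real) \<Rightarrow> 'a \<Rightarrow> real" where
  "laplacian f = dvg (grad f)"

subsection \<open>Phase-field models\<close>

datatype mbe_variant = Slope_Selection | No_Slope_Selection

datatype model = Allen_Cahn | Cahn_Hilliard | MBE mbe_variant

primrec F_mbe :: "mbe_variant \<Rightarrow> 'a::euclidean_space \<Rightarrow> real" where
  "F_mbe Slope_Selection p = 1 / 4 * (1 - (norm p)\<^sup>2)\<^sup>2"
| "F_mbe No_Slope_Selection p = - (1 / 2) * ln (1 + (norm p)\<^sup>2)"

primrec f_mbe :: "mbe_variant \<Rightarrow> 'a::euclidean_space \<Rightarrow> 'a" where
  "f_mbe Slope_Selection p = p - (norm p)\<^sup>2 *\<^sub>R p"
| "f_mbe No_Slope_Selection p = (1 / (1 + (norm p)\<^sup>2)) *\<^sub>R p"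

primrec G_op :: "model \<Rightarrow> ('a::euclidean_space \<Rightarrow> real) \<Rightarrow> 'a \<Rightarrow> real" where
  "G_op Allen_Cahn u = (\<lambda>x. - u x)"
| "G_op Cahn_Hilliard u = laplacian u"
| "G_op (MBE v) u = (\<lambda>x. - u x)"

primrec L_op :: "model \<Rightarrow> real \<Rightarrow> ('a::euclidean_space \<Rightarrow> real) \<Rightarrow> 'a \<Rightarrow> real" where
  "L_op Allen_Cahn \<epsilon> u = (\<lambda>x. - \<epsilon>\<^sup>2 * laplacian u x)"
| "L_op Cahn_Hilliard \<epsilon> u = (\<lambda>x. - \<epsilon>\<^sup>2 * laplacian u x)"
| "L_op (MBE v) \<epsilon> u = (\<lambda>x. \<epsilon>\<^sup>2 * laplacian (laplacian u) x)"

primrec E1 :: "model \<Rightarrow> 'a::euclidean_space \<Rightarrow> 'a \<Rightarrow> ('a \<Rightarrow> real) \<Rightarrow> real" where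
  "E1 Allen_Cahn a b u = integral (cbox a b) (\<lambda>x. 1 / 4 * (1 - (u x)\<^sup>2)\<^sup>2)"
| "E1 Cahn_Hilliard a b u = integral (cbox a b) (\<lambda>x. 1 / 4 * (1 - (u x)\<^sup>2)\<^sup>2)"
| "E1 (MBE v) a b u = integral (cbox a b) (\<lambda>x. F_mbe v (grad u x))"

primrec delta_E1 :: "model \<Rightarrow> ('a::euclidean_space \<Rightarrow> real) \<Rightarrow> 'a \<Rightarrow> real" where
  "delta_E1 Allen_Cahn u = (\<lambda>x. (u x) ^ 3 - u x)"
| "delta_E1 Cahn_Hilliard u = (\<lambda>x. (u x) ^ 3 - u x)"
| "delta_E1 (MBE v) u = dvg (\<lambda>x. f_mbe v (grad u x))"

text \<open>
  The least classical differentiability for which the compositions of the above operators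
  occurring in the scheme make sense for each iterate and are continuous.
\<close>

primrec reg_order :: "model \<Rightarrow> nat" where
  "reg_order Allen_Cahn = 2"
| "reg_order Cahn_Hilliard = 4"
| "reg_order (MBE v) = 4"

subsection \<open>Discrete time\<close>

definition bdiff :: "real \<Rightarrow> (nat \<Rightarrow> real) \<Rightarrow> nat \<Rightarrow> real" where
  "bdiff dt v k = (v k - v (k - 1)) / dt"

definition b_coeff :: "real \<Rightarrow> real \<Rightarrow> nat \<Rightarrow> real" where
  "b_coeff \<alpha> dt j =
     (if j = 0 then dt powr (1 - \<alpha>) * 2 powr (\<alpha> - 1) / Gamma (2 - \<alpha>)
      else dt powr (1 - \<alpha>) / Gamma (2 - \<alpha>) *
             ((real j + 1 / 2) powr (1 - \<alpha>) - (real j - 1 / 2) powr (1 - \<alpha>)))"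

text \<open>\<open>frac_diff \<alpha> dt v n\<close> is the fractional difference of \<open>v\<close> at the half step \<open>n + 1/2\<close>.\<close>

definition frac_diff :: "real \<Rightarrow> real \<Rightarrow> (nat \<Rightarrow> real) \<Rightarrow> nat \<Rightarrow> real" where
  "frac_diff \<alpha> dt v n = (\<Sum>j=0..n. b_coeff \<alpha> dt (n - j) * bdiff dt v (j + 1))"

text \<open>
  \<open>mid v n\<close>, \<open>mid_fun \<phi> n\<close> and \<open>extrap \<phi>m \<phi> n\<close> also belong to the half step \<open>n + 1/2\<close>;
  \<open>\<phi>m\<close> is the starting value with index \<open>-1\<close>.
\<close>

definition mid :: "(nat \<Rightarrow> real) \<Rightarrow> nat \<Rightarrow> real" where
  "mid v n = 1 / 2 * (v (n + 1) + v n)"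

definition mid_fun :: "(nat \<Rightarrow> 'a \<Rightarrow> real) \<Rightarrow> nat \<Rightarrow> 'a \<Rightarrow> real" where
  "mid_fun \<phi> n x = mid (\<lambda>k. \<phi> k x) n"

definition extrap :: "('a \<Rightarrow> real) \<Rightarrow> (nat \<Rightarrow> 'a \<Rightarrow> real) \<Rightarrow> nat \<Rightarrow> 'a \<Rightarrow> real" where
  "extrap \<phi>m \<phi> n x = 3 / 2 * \<phi> n x - 1 / 2 * (if n = 0 then \<phi>m x else \<phi> (n - 1) x)"

definition mod_energy ::
  "model \<Rightarrow> real \<Rightarrow> 'a::euclidean_space \<Rightarrow> 'a \<Rightarrow> (nat \<Rightarrow> 'a \<Rightarrow> real) \<Rightarrow> (nat \<Rightarrow> real) \<Rightarrow> nat \<Rightarrow> real" where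
  "mod_energy M \<epsilon> a b \<phi> r n = 1 / 2 * L2_inner a b (L_op M \<epsilon> (\<phi> n)) (\<phi> n) + (r n)\<^sup>2"

end

theory Submission
  imports Defs
begin

text \<open>
  Testing the equation for \<open>\<mu>\<close> with \<open>\<phi>\<close>-increments and the equation for \<open>r\<close> with \<open>2 r\<close> at the half step
  cancels the nonlinear terms, so that (\<open>energy_increment\<close>) the discrete rate of the modified
  energy is the \<open>L\<^sup>2\<close> product of \<open>\<mu>\<close> and the rate \<open>D k\<close> of \<open>\<phi>\<close>, both at step \<open>k\<close>. The first equation
  of the scheme expresses \<open>\<mu>\<close> through the history of \<open>\<phi>\<close>, and turns this rate into
  \<open>- (1 / \<gamma>)\<close> times a sum of convolution terms \<open>\<Sum>j\<le>k. b (k - j) * \<langle>y j, y k\<rangle>\<close>. If \<open>\<G> = - 1\<close>, then \<open>y = D\<close>.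
  If \<open>\<G> = \<Delta>\<close>, solving the triangular convolution equation \<open>\<gamma> \<mu> = b * w\<close> for \<open>w\<close> gives functions
  with \<open>\<Delta> w = D\<close>, which plays the part of an inverse Laplacian, and an integration by
  parts yields the same form with \<open>y\<close> running through the partial derivatives of \<open>w\<close>.

  Both claims are therefore statements on quadratic forms in real variables, which may be applied
  pointwise and integrated (\<open>L2_form_nonneg\<close>): summing the rates over \<open>k \<le> n\<close> with weights \<open>1\<close> gives the
  energy bound and with weights \<open>b (n - k)\<close> the fractional law. The symmetrised kernel is
  \<open>c (l - i)\<close> in the first case and, after reversing time, \<open>b i * c (l - i)\<close> for \<open>i \<le> l\<close> in the second, where
  \<open>c\<close> is \<open>b\<close> with its first weight doubled.
  A kernel given on \<open>i \<le> l\<close> is positive semidefinite if it is a nonnegative combination of indicators of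
  \<open>p \<le> i \<and> l \<le> q\<close>, since each indicator contributes the square of a partial sum; the coefficients
  are the mixed differences of the kernel (\<open>interval_kernel_nonneg\<close>). For the first kernel their
  nonnegativity is convexity of \<open>c\<close>. The second one is first divided by \<open>c i * c l\<close>; the mixed
  differences of \<open>c (l - i) / c l\<close> are nonnegative exactly because \<open>c\<close> is log-convex. That \<open>c\<close> is
  log-convex comes from writing \<open>c m\<close> as the integral of the log-convex function \<open>\<beta> s\<^bsup>\<beta> - 1\<^esup>\<close> over
  \<open>[m - 1/2, m + 1/2]\<close>, with \<open>\<beta> = 1 - \<alpha>\<close>, except at the singular first interval, where it is the
  inequality \<open>9\<^bsup>\<beta>\<^esup> + 1 \<le> 2 * 5\<^bsup>\<beta>\<^esup>\<close>.
\<close>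

section \<open>Positive semidefinite kernels\<close>

lemma double_sum_min_max:
  fixes S :: "nat \<Rightarrow> nat \<Rightarrow> real"
  shows "(\<Sum>i\<le>n. \<Sum>l\<le>n. S (min i l) (max i l)) = (\<Sum>k\<le>n. S k k + 2 * (\<Sum>j<k. S j k))"
proof (induction n)
  case (Suc n)
  have "(\<Sum>i\<le>Suc n. \<Sum>l\<le>Suc n. S (min i l) (max i l))
      = (\<Sum>i\<le>n. \<Sum>l\<le>n. S (min i l) (max i l)) + (\<Sum>i\<le>n. S i (Suc n))
        + ((\<Sum>l\<le>n. S l (Suc n)) + S (Suc n) (Suc n))"
    by (simp add: sum.distrib min_absorb1 min_absorb2 max_absorb1 max_absorb2)
  then show ?case
    using Suc by (simp add: lessThan_Suc_atMost)
qed simp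

text \<open>
  Summation by parts: with \<open>Z p\<close> the sum of \<open>z i\<close> over \<open>p \<le> i\<close>, the form equals
  \<open>a 0 * (Z 0)\<^sup>2 + (\<Sum>p. (a (p + 1) - a p) * (Z (p + 1))\<^sup>2)\<close>. The induction splits off one square at a time.
\<close>

lemma min_kernel_nonneg:
  fixes a z :: "nat \<Rightarrow> real"
  assumes "0 \<le> a 0" "\<And>p. p < n \<Longrightarrow> a p \<le> a (Suc p)"
  shows "0 \<le> (\<Sum>i\<le>n. \<Sum>l\<le>n. a (min i l) * (z i * z l))"
  using assms
proof (induction n arbitrary: a z)
  case 0
  then show ?case by simp
next
  case (Suc n)
  define a' where "a' p = a (Suc p) - a 0" for p
  define z' where "z' p = z (Suc p)" for p
  have "(\<Sum>i\<le>Suc n. \<Sum>l\<le>Suc n. a (min i l) * (z i * z l))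
     = (\<Sum>i\<le>Suc n. \<Sum>l\<le>Suc n. (a (min i l) - a 0) * (z i * z l))
        + (\<Sum>i\<le>Suc n. \<Sum>l\<le>Suc n. a 0 * (z i * z l))"
    unfolding sum.distrib[symmetric] by (simp only: ring_distribs diff_add_cancel)
  also have "(\<Sum>i\<le>Suc n. \<Sum>l\<le>Suc n. (a (min i l) - a 0) * (z i * z l))
     = (\<Sum>i\<le>n. \<Sum>l\<le>n. a' (min i l) * (z' i * z' l))"
    by (simp add: sum.atMost_Suc_shift a'_def z'_def del: sum.atMost_Suc)
  also have "(\<Sum>i\<le>Suc n. \<Sum>l\<le>Suc n. a 0 * (z i * z l)) = a 0 * (\<Sum>i\<le>Suc n. z i)\<^sup>2"
    unfolding power2_eq_square sum_product by (simp only: sum_distrib_left)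
  finally have eq: "(\<Sum>i\<le>Suc n. \<Sum>l\<le>Suc n. a (min i l) * (z i * z l))
     = (\<Sum>i\<le>n. \<Sum>l\<le>n. a' (min i l) * (z' i * z' l)) + a 0 * (\<Sum>i\<le>Suc n. z i)\<^sup>2" .
  have "0 \<le> (\<Sum>i\<le>n. \<Sum>l\<le>n. a' (min i l) * (z' i * z' l))"
    by (rule Suc.IH) (use Suc.prems in \<open>auto simp: a'_def\<close>)
  then show ?case
    unfolding eq using Suc.prems by (intro add_nonneg_nonneg) auto
qed

text \<open>
  The hypotheses say that \<open>Q\<close>, extended by zero to \<open>p = -1\<close> and to \<open>q = n + 1\<close>, has nonnegative mixed
  differences, which are the coefficients of \<open>Q\<close> in terms of indicators of \<open>p \<le> i \<and> l \<le> q\<close>.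
  The induction on \<open>n\<close> collects the indicators with \<open>q = n\<close>; they form a kernel that depends on
  \<open>min i l\<close> alone.
\<close>

lemma interval_kernel_nonneg:
  fixes Q :: "nat \<Rightarrow> nat \<Rightarrow> real"
  assumes "0 \<le> Q 0 n"
    and "\<And>p. p < n \<Longrightarrow> Q p n \<le> Q (Suc p) n"
    and "\<And>q. q < n \<Longrightarrow> Q 0 (Suc q) \<le> Q 0 q"
    and "\<And>p q. p < q \<Longrightarrow> q < n \<Longrightarrow> Q p q - Q p (Suc q) \<le> Q (Suc p) q - Q (Suc p) (Suc q)"
  shows "0 \<le> (\<Sum>i\<le>n. \<Sum>l\<le>n. Q (min i l) (max i l) * (z i * z l))"
  using assms
proof (induction n arbitrary: Q)
  case 0
  then show ?case by simp
next
  case (Suc n)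
  define Q' where "Q' i l = Q i l - Q i (Suc n)" for i l
  have "(\<Sum>i\<le>Suc n. \<Sum>l\<le>Suc n. Q (min i l) (max i l) * (z i * z l))
     = (\<Sum>i\<le>Suc n. \<Sum>l\<le>Suc n. Q' (min i l) (max i l) * (z i * z l))
        + (\<Sum>i\<le>Suc n. \<Sum>l\<le>Suc n. Q (min i l) (Suc n) * (z i * z l))"
    unfolding sum.distrib[symmetric] Q'_def by (simp only: ring_distribs diff_add_cancel)
  also have "(\<Sum>i\<le>Suc n. \<Sum>l\<le>Suc n. Q' (min i l) (max i l) * (z i * z l))
     = (\<Sum>i\<le>n. \<Sum>l\<le>n. Q' (min i l) (max i l) * (z i * z l))"
    by (simp add: Q'_def max_absorb1 max_absorb2)
  finally have eq: "(\<Sum>i\<le>Suc n. \<Sum>l\<le>Suc n. Q (min i l) (max i l) * (z i * z l))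
     = (\<Sum>i\<le>n. \<Sum>l\<le>n. Q' (min i l) (max i l) * (z i * z l))
        + (\<Sum>i\<le>Suc n. \<Sum>l\<le>Suc n. Q (min i l) (Suc n) * (z i * z l))" .
  have "0 \<le> (\<Sum>i\<le>n. \<Sum>l\<le>n. Q' (min i l) (max i l) * (z i * z l))"
  proof (rule Suc.IH)
    show "0 \<le> Q' 0 n" using Suc.prems(3)[of n] by (simp add: Q'_def)
    show "Q' p n \<le> Q' (Suc p) n" if "p < n" for p
      using Suc.prems(4)[of p n] that by (simp add: Q'_def)
    show "Q' 0 (Suc q) \<le> Q' 0 q" if "q < n" for q
      using Suc.prems(3)[of q] that by (simp add: Q'_def)
    show "Q' p q - Q' p (Suc q) \<le> Q' (Suc p) q - Q' (Suc p) (Suc q)" if "p < q" "q < n" for p q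
      using Suc.prems(4)[of p q] that by (simp add: Q'_def)
  qed
  moreover have "0 \<le> (\<Sum>i\<le>Suc n. \<Sum>l\<le>Suc n. Q (min i l) (Suc n) * (z i * z l))"
    by (rule min_kernel_nonneg) (use Suc.prems in auto)
  ultimately show ?case
    unfolding eq by (rule add_nonneg_nonneg)
qed

section \<open>Convolution forms with log-convex weights\<close>

text \<open>
  Twice the form \<open>\<Sum>k. \<Sum>j\<le>k. b (k - j) * y j * y k\<close> is a symmetric sum over all pairs: each
  off-diagonal term splits into two equal ones, and the diagonal is doubled, hence \<open>c 0 = 2 * b 0\<close>. All conditions
  concern this modified sequence \<open>c\<close>: the weights of the scheme themselves need not even decrease
  from \<open>b 0\<close> to \<open>b 1\<close>.
\<close>

locale log_convex_kernel =
  fixes b c :: "nat \<Rightarrow> real"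
  assumes c_eq: "\<And>m. c m = (if m = 0 then 2 * b 0 else b m)"
    and pos: "\<And>m. 0 < c m"
    and decr: "\<And>m. c (Suc m) \<le> c m"
    and log_convex: "\<And>m. (c (Suc m))\<^sup>2 \<le> c m * c (Suc (Suc m))"
begin

lemma ratio_mono:
  assumes "m \<le> k"
  shows "c (Suc m) / c m \<le> c (Suc k) / c k"
  using assms
proof (induction k rule: dec_induct)
  case (step k)
  have "c (Suc k) / c k \<le> c (Suc (Suc k)) / c (Suc k)"
    using log_convex[of k] pos[of k] pos[of "Suc k"]
    by (simp add: field_simps power2_eq_square)
  then show ?case using step by simp
qed simp

text \<open>
  By the inequality between geometric and arithmetic mean, log-convexity implies convexity.
\<close>

lemma weights_convex: "c (Suc m) - c (Suc (Suc m)) \<le> c m - c (Suc m)"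
proof -
  have "(2 * c (Suc m))\<^sup>2 \<le> (c m + c (Suc (Suc m)))\<^sup>2"
    using log_convex[of m] zero_le_power2[of "c m - c (Suc (Suc m))"]
    by (simp add: power2_eq_square algebra_simps)
  then have "2 * c (Suc m) \<le> c m + c (Suc (Suc m))"
    by (rule power2_le_imp_le) (use pos[of m] pos[of "Suc (Suc m)"] in simp)
  then show ?thesis by simp
qed

text \<open>
  The mixed-difference condition for the kernel \<open>c (l - i) / c l\<close>. Passing from \<open>m\<close> to \<open>m + 1\<close> shrinks the
  increments of \<open>c\<close> at least by the factor \<open>c (m + 2) / c (m + 1)\<close>, and ratios of successive weights
  only grow towards \<open>c (q + 1) / c q\<close>.
\<close>

lemma scaled_convex:
  assumes "m < q"
  shows "(c (Suc m) - c (Suc (Suc m))) / c (Suc q) \<le> (c m - c (Suc m)) / c q"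
proof -
  have "c (Suc m) - c (Suc (Suc m)) \<le> (c m - c (Suc m)) * (c (Suc (Suc m)) / c (Suc m))"
    using log_convex[of m] pos[of "Suc m"] by (simp add: field_simps power2_eq_square)
  also have "\<dots> \<le> (c m - c (Suc m)) * (c (Suc q) / c q)"
    using ratio_mono[of "Suc m" q] assms decr[of m] by (intro mult_left_mono) auto
  finally show ?thesis
    using pos[of q] pos[of "Suc q"] by (simp add: field_simps)
qed

lemma twice_weighted_form:
  "2 * (\<Sum>k\<le>n. d k * (\<Sum>j\<le>k. b (k - j) * (y j * y k)))
    = (\<Sum>i\<le>n. \<Sum>l\<le>n. d (max i l) * c (max i l - min i l) * (y i * y l))"
proof -
  define S where "S j k = d k * c (k - j) * (y j * y k)" for j k
  have "(\<Sum>i\<le>n. \<Sum>l\<le>n. d (max i l) * c (max i l - min i l) * (y i * y l))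
      = (\<Sum>i\<le>n. \<Sum>l\<le>n. S (min i l) (max i l))"
    by (intro sum.cong refl) (auto simp: S_def min_def max_def)
  also have "\<dots> = (\<Sum>k\<le>n. S k k + 2 * (\<Sum>j<k. S j k))"
    by (rule double_sum_min_max)
  also have "\<dots> = (\<Sum>k\<le>n. 2 * (d k * (\<Sum>j\<le>k. b (k - j) * (y j * y k))))"
  proof (intro sum.cong refl)
    fix k
    have "(\<Sum>j<k. S j k) = d k * (\<Sum>j<k. b (k - j) * (y j * y k))"
      unfolding sum_distrib_left by (intro sum.cong refl) (auto simp: S_def c_eq)
    moreover have "S k k = 2 * (d k * (b 0 * (y k * y k)))"
      by (simp add: S_def c_eq)
    ultimately show "S k k + 2 * (\<Sum>j<k. S j k) = 2 * (d k * (\<Sum>j\<le>k. b (k - j) * (y j * y k)))"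
      by (simp add: lessThan_Suc_atMost[symmetric] algebra_simps)
  qed
  finally show ?thesis by (simp add: sum_distrib_left)
qed

lemma convolution_form_nonneg:
  "0 \<le> (\<Sum>k\<le>n. \<Sum>j\<le>k. b (k - j) * (y j * y k))"
proof -
  have "0 \<le> (\<Sum>i\<le>n. \<Sum>l\<le>n. c (max i l - min i l) * (y i * y l))"
  proof (rule interval_kernel_nonneg[where Q = "\<lambda>i l. c (l - i)"])
    show "c (n - p) \<le> c (n - Suc p)" if "p < n" for p
      using decr[of "n - Suc p"] that by (simp add: Suc_diff_Suc)
    show "c (q - p) - c (Suc q - p) \<le> c (q - Suc p) - c (Suc q - Suc p)" if "p < q" "q < n" for p q
    proof -
      obtain m where "q = Suc (p + m)" using \<open>p < q\<close> less_imp_Suc_add by blast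
      then show ?thesis using weights_convex[of m] by simp
    qed
  qed (use pos decr in \<open>auto simp: less_imp_le\<close>)
  then show ?thesis
    using twice_weighted_form[where n = n and d = "\<lambda>_. 1" and y = y] by simp
qed

text \<open>
  With \<open>i = n - k\<close> and \<open>l = n - j\<close> the symmetric kernel becomes \<open>b i * c (l - i)\<close> for \<open>i \<le> l\<close>. Its first
  factor decreases in \<open>i\<close> while the second increases, so it lacks the monotonicity in \<open>i\<close> that
  \<open>interval_kernel_nonneg\<close> asks for. Dividing by \<open>c i * c l\<close>, which amounts to rescaling the variables,
  makes it \<open>c (l - i) / c l\<close> except in row \<open>0\<close>, where it is the constant \<open>1 / 2\<close>.
\<close>

lemma double_convolution_form_nonneg:
  "0 \<le> (\<Sum>k\<le>n. b (n - k) * (\<Sum>j\<le>k. b (k - j) * (y j * y k)))"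
proof -
  define z where "z i = c i * y (n - i)" for i
  define h where "h i = (if i = 0 then 1 / 2 else (1::real))" for i :: nat
  define Q where "Q i l = h i * (c (l - i) / c l)" for i l
  have b_h: "b i = h i * c i" for i
    by (simp add: h_def c_eq)
  have "0 \<le> (\<Sum>i\<le>n. \<Sum>l\<le>n. Q (min i l) (max i l) * (z i * z l))"
  proof (rule interval_kernel_nonneg)
    show "0 \<le> Q 0 n"
      using pos[of n] by (simp add: Q_def h_def)
    show "Q p n \<le> Q (Suc p) n" if "p < n" for p
    proof -
      have "c (n - p) \<le> c (n - Suc p)"
        using decr[of "n - Suc p"] that by (simp add: Suc_diff_Suc)
      then show ?thesis
        unfolding Q_def using pos[of n] pos[of "n - p"]
        by (intro mult_mono divide_right_mono) (auto simp: h_def less_imp_le)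
    qed
    show "Q 0 (Suc q) \<le> Q 0 q" if "q < n" for q
      using pos[of q] pos[of "Suc q"] by (simp add: Q_def)
    show "Q p q - Q p (Suc q) \<le> Q (Suc p) q - Q (Suc p) (Suc q)" if "p < q" "q < n" for p q
    proof -
      obtain m where m: "q = Suc (p + m)" using \<open>p < q\<close> less_imp_Suc_add by blast
      have *: "c (Suc m) / c q - c (Suc (Suc m)) / c (Suc q) \<le> c m / c q - c (Suc m) / c (Suc q)"
        using scaled_convex[of m q] m by (simp add: diff_divide_distrib)
      show ?thesis
      \<comment> \<open>The row \<open>0\<close> is constant, and so is the row that the quotient \<open>c (l - i) / c l\<close> would have there;
        the halving affects neither side of the inequality.\<close>
      proof (cases "p = 0")
        case True
        then have "Q p q - Q p (Suc q) = 0"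
          using pos[of q] pos[of "Suc q"] by (simp add: Q_def)
        moreover have "0 \<le> Q (Suc p) q - Q (Suc p) (Suc q)"
          using * True m pos[of q] pos[of "Suc q"] by (simp add: Q_def h_def)
        ultimately show ?thesis by simp
      next
        case False
        then show ?thesis
          using * m by (simp add: Q_def h_def)
      qed
    qed
  qed
  also have "(\<Sum>i\<le>n. \<Sum>l\<le>n. Q (min i l) (max i l) * (z i * z l))
      = (\<Sum>i\<le>n. \<Sum>l\<le>n. b (min i l) * c (max i l - min i l) * (y (n - i) * y (n - l)))"
  proof (intro sum.cong refl)
    fix i l
    have "c (max i l) > 0" by (rule pos)
    moreover have "c i * c l = c (min i l) * c (max i l)"
      by (simp add: min_def max_def)
    ultimately have "Q (min i l) (max i l) * (c i * c l) = b (min i l) * c (max i l - min i l)"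
      by (simp add: Q_def b_h)
    then show "Q (min i l) (max i l) * (z i * z l)
        = b (min i l) * c (max i l - min i l) * (y (n - i) * y (n - l))"
      by (simp add: z_def algebra_simps)
  qed
  also have "\<dots> = (\<Sum>i\<le>n. \<Sum>l\<le>n. b (n - max i l) * c (max i l - min i l) * (y i * y l))"
  proof (rule sum.reindex_bij_witness[where i = "\<lambda>i. n - i" and j = "\<lambda>i. n - i"])
    fix i assume i: "i \<in> {..n}"
    show "(\<Sum>l\<le>n. b (n - max (n - i) l) * c (max (n - i) l - min (n - i) l) * (y (n - i) * y l))
      = (\<Sum>l\<le>n. b (min i l) * c (max i l - min i l) * (y (n - i) * y (n - l)))"
    proof (rule sum.reindex_bij_witness[where i = "\<lambda>i. n - i" and j = "\<lambda>i. n - i"])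
      fix l assume l: "l \<in> {..n}"
      have "n - max (n - i) l = min i (n - l)"
        "max (n - i) l - min (n - i) l = max i (n - l) - min i (n - l)"
        using i l by (auto simp: min_def max_def)
      then show "b (min i (n - l)) * c (max i (n - l) - min i (n - l)) * (y (n - i) * y (n - (n - l)))
        = b (n - max (n - i) l) * c (max (n - i) l - min (n - i) l) * (y (n - i) * y l)"
        using l by simp
    qed auto
  qed auto
  finally show ?thesis
    using twice_weighted_form[where n = n and d = "\<lambda>k. b (n - k)" and y = y] by simp
qed

end

section \<open>Log-convexity of the time-stepping weights\<close>

lemma four_mult_le_square_add: "4 * p * q \<le> (p + q)\<^sup>2" for p q :: real
  using zero_le_power2[of "p - q"] by (simp add: power2_eq_square algebra_simps)

text \<open>
  Bernoulli's inequality for an exponent between \<open>0\<close> and \<open>1\<close>.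
\<close>

lemma powr_le_tangent:
  fixes x \<beta> :: real
  assumes "0 < x" "0 \<le> \<beta>" "\<beta> \<le> 1"
  shows "x powr \<beta> \<le> 1 + \<beta> * (x - 1)"
  using Youngs_inequality_0[of \<beta> "1 - \<beta>" x 1] assms by (simp add: algebra_simps)

text \<open>
  The integral of \<open>\<beta> * \<bar>s\<bar> powr (\<beta> - 1)\<close> over \<open>{m - 1/2..m + 1/2}\<close>. Up to a constant factor this is \<open>b_coeff\<close> with the
  first coefficient doubled: the interval for \<open>m = 0\<close> lies on both sides of the singularity.
\<close>

definition L1_weight :: "real \<Rightarrow> nat \<Rightarrow> real" where
  "L1_weight \<beta> m = (if m = 0 then 2 * (1 / 2) powr \<beta>
                    else (real m + 1 / 2) powr \<beta> - (real m - 1 / 2) powr \<beta>)"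

context
  fixes \<beta> :: real
  assumes beta: "0 < \<beta>" "\<beta> < 1"
begin

lemma L1_weight_pos: "0 < L1_weight \<beta> m"
  using beta by (auto simp: L1_weight_def intro!: powr_less_mono2)

lemma L1_weight_first:
  "L1_weight \<beta> 0 = 2 * (1 / 2) powr \<beta>"
  "L1_weight \<beta> 1 = (3 powr \<beta> - 1) * (1 / 2) powr \<beta>"
  "L1_weight \<beta> 2 = (5 powr \<beta> - 3 powr \<beta>) * (1 / 2) powr \<beta>"
  by (simp_all add: L1_weight_def powr_divide diff_divide_distrib left_diff_distrib)

lemma L1_weight_decr: "L1_weight \<beta> (Suc m) \<le> L1_weight \<beta> m"
proof (cases m)
  case 0
  have "3 powr \<beta> \<le> 3" using powr_mono[of \<beta> 1 3] beta by simp
  then show ?thesis using 0 L1_weight_first by simp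
next
  case (Suc k)
  define g where "g s = (s + 1) powr \<beta> - s powr \<beta>" for s
  have "g (real m + 1 / 2) \<le> g (real m - 1 / 2)"
  proof (rule DERIV_nonpos_imp_nonincreasing[where f = g])
    fix s :: real assume s: "real m - 1 / 2 \<le> s"
    have p: "0 < s" using s Suc by simp
    have "(g has_real_derivative \<beta> * ((s + 1) powr (\<beta> - 1) - s powr (\<beta> - 1))) (at s)"
      unfolding g_def using p by (auto intro!: derivative_eq_intros simp: field_simps)
    moreover have "(s + 1) powr (\<beta> - 1) \<le> s powr (\<beta> - 1)"
      using p beta by (intro powr_mono2') auto
    then have "\<beta> * ((s + 1) powr (\<beta> - 1) - s powr (\<beta> - 1)) \<le> 0"
      using beta by (intro mult_nonneg_nonpos) auto
    ultimately show "\<exists>y. (g has_real_derivative y) (at s) \<and> y \<le> 0" by blast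
  qed simp
  then show ?thesis
    using Suc by (simp add: g_def L1_weight_def algebra_simps)
qed

text \<open>
  For \<open>m \<ge> 1\<close> the integrands satisfy \<open>2 M \<le> t A + B / t\<close> for every \<open>t > 0\<close>, because \<open>M\<^sup>2 \<le> A B\<close>; integrating, here
  in the guise of a monotone primitive, transfers this to the weights, and the best \<open>t\<close> gives the claim.
  For \<open>m = 0\<close> pointwise comparison fails near the ends of the interval. After clearing the powers
  of two, the claim is \<open>9\<^bsup>\<beta>\<^esup> + 1 \<le> 2 * 5\<^bsup>\<beta>\<^esup>\<close>, that is \<open>(9 / 5)\<^bsup>\<beta>\<^esup> + (1 / 5)\<^bsup>\<beta>\<^esup> \<le> 2\<close>, whose left side is convex
  in \<open>\<beta>\<close> with value \<open>2\<close> at \<open>\<beta> = 0\<close> and \<open>\<beta> = 1\<close>; the Bernoulli bounds for the two powers add up to exactly \<open>2\<close>.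
\<close>

lemma L1_weight_log_convex: "(L1_weight \<beta> (Suc m))\<^sup>2 \<le> L1_weight \<beta> m * L1_weight \<beta> (Suc (Suc m))"
proof (cases m)
  case 0
  have "(9 / 5) powr \<beta> + (1 / 5) powr \<beta> \<le> 2"
    using powr_le_tangent[of "9 / 5" \<beta>] powr_le_tangent[of "1 / 5" \<beta>] beta by simp
  then have "9 powr \<beta> + 1 \<le> 2 * 5 powr \<beta>"
    by (simp add: powr_divide field_simps)
  moreover have "9 powr \<beta> = 3 powr \<beta> * 3 powr \<beta>"
    using powr_mult[of 3 3 \<beta>] by simp
  ultimately have "(3 powr \<beta> - 1)\<^sup>2 \<le> 2 * (5 powr \<beta> - 3 powr \<beta>)"
    by (simp add: power2_eq_square algebra_simps)
  then have "((3 powr \<beta> - 1) * (1 / 2) powr \<beta>)\<^sup>2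
      \<le> 2 * (1 / 2) powr \<beta> * ((5 powr \<beta> - 3 powr \<beta>) * (1 / 2) powr \<beta>)"
    using mult_right_mono[of "(3 powr \<beta> - 1)\<^sup>2" _ "((1 / 2) powr \<beta>)\<^sup>2"]
    by (simp add: power_mult_distrib power2_eq_square mult_ac)
  then show ?thesis
    unfolding 0 L1_weight_first[symmetric] by (simp add: numeral_2_eq_2)
next
  case (Suc k)
  then have m: "1 \<le> m" by simp
  have amgm: "2 * L1_weight \<beta> (Suc m) \<le> t * L1_weight \<beta> m + L1_weight \<beta> (Suc (Suc m)) / t" if "0 < t" for t
  proof -
    define h where "h s = t * (real m + s) powr \<beta> + (real m + 2 + s) powr \<beta> / t - 2 * (real m + 1 + s) powr \<beta>" for s
    have "h (- 1 / 2) \<le> h (1 / 2)"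
    proof (rule DERIV_nonneg_imp_nondecreasing[where f = h])
      fix s :: real assume s: "- 1 / 2 \<le> s" "s \<le> 1 / 2"
      let ?A = "(real m + s) powr (\<beta> - 1)" and ?B = "(real m + 2 + s) powr (\<beta> - 1)"
        and ?M = "(real m + 1 + s) powr (\<beta> - 1)"
      have p: "0 < real m + s" using m s by linarith
      have d: "((\<lambda>s. (real m + x + s) powr \<beta>) has_real_derivative
          \<beta> * (real m + x + s) powr (\<beta> - 1)) (at s)" if "0 \<le> x" for x
        using DERIV_fun_powr[of "\<lambda>s. real m + x + s" 1 s \<beta>] p that
        by (auto intro!: derivative_eq_intros)
      have "(h has_real_derivative
          t * (\<beta> * ?A) + \<beta> * ?B / t - 2 * (\<beta> * ?M)) (at s)"
        unfolding h_def using d[of 0] d[of 1] d[of 2]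
        by (intro DERIV_add DERIV_diff DERIV_cmult DERIV_cdivide) auto
      moreover have "0 \<le> t * (\<beta> * ?A) + \<beta> * ?B / t - 2 * (\<beta> * ?M)"
      proof -
        have "?M\<^sup>2 = ((real m + 1 + s)\<^sup>2) powr (\<beta> - 1)"
          using p by (simp add: power2_eq_square powr_mult)
        also have "\<dots> \<le> ((real m + s) * (real m + 2 + s)) powr (\<beta> - 1)"
        proof (rule powr_mono2')
          show "0 < (real m + s) * (real m + 2 + s)" using p by (intro mult_pos_pos) auto
          show "(real m + s) * (real m + 2 + s) \<le> (real m + 1 + s)\<^sup>2"
            by (simp add: power2_eq_square algebra_simps)
        qed (use beta in simp)
        also have "\<dots> = ?A * ?B"
          using p by (simp add: powr_mult)
        finally have "(2 * ?M)\<^sup>2 \<le> 4 * (t * ?A) * (?B / t)"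
          using that by (simp add: power2_eq_square)
        also have "\<dots> \<le> (t * ?A + ?B / t)\<^sup>2"
          by (rule four_mult_le_square_add)
        finally have "2 * ?M \<le> t * ?A + ?B / t"
          by (rule power2_le_imp_le) (use that in simp)
        then have "\<beta> * (2 * ?M) \<le> \<beta> * (t * ?A + ?B / t)"
          using beta by (intro mult_left_mono) auto
        then show ?thesis by (simp add: algebra_simps)
      qed
      ultimately show "\<exists>y. (h has_real_derivative y) (at s) \<and> 0 \<le> y" by blast
    qed simp
    then show ?thesis
      using m that by (simp add: h_def L1_weight_def algebra_simps add_divide_distrib diff_divide_distrib)
  qed
  show ?thesis
    using amgm[of "L1_weight \<beta> (Suc m) / L1_weight \<beta> m"] L1_weight_pos[of m] L1_weight_pos[of "Suc m"]
    by (simp add: field_simps power2_eq_square)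
qed

end

lemma log_convex_kernel_b_coeff:
  assumes "0 < \<alpha>" "\<alpha> < 1" "0 < dt"
  shows "log_convex_kernel (b_coeff \<alpha> dt) (\<lambda>m. dt powr (1 - \<alpha>) / Gamma (2 - \<alpha>) * L1_weight (1 - \<alpha>) m)"
proof
  define K where "K = dt powr (1 - \<alpha>) / Gamma (2 - \<alpha>)"
  have K: "0 < K" using assms by (auto simp: K_def intro!: divide_pos_pos Gamma_real_pos)
  have \<beta>: "0 < 1 - \<alpha>" "1 - \<alpha> < 1" using assms by auto
  have half: "(1 / 2) powr (1 - \<alpha>) = 2 powr (\<alpha> - 1)"
    by (simp add: powr_divide powr_minus_divide[of 2 "1 - \<alpha>", simplified])
  fix m
  show "K * L1_weight (1 - \<alpha>) m = (if m = 0 then 2 * b_coeff \<alpha> dt 0 else b_coeff \<alpha> dt m)"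
    by (simp add: K_def L1_weight_def b_coeff_def half)
  show "0 < K * L1_weight (1 - \<alpha>) m"
    using K L1_weight_pos[OF \<beta>] by simp
  show "K * L1_weight (1 - \<alpha>) (Suc m) \<le> K * L1_weight (1 - \<alpha>) m"
    using K L1_weight_decr[OF \<beta>] by simp
  show "(K * L1_weight (1 - \<alpha>) (Suc m))\<^sup>2
      \<le> K * L1_weight (1 - \<alpha>) m * (K * L1_weight (1 - \<alpha>) (Suc (Suc m)))"
    using mult_left_mono[OF L1_weight_log_convex[OF \<beta>, of m], of "K\<^sup>2"]
    by (simp add: power_mult_distrib power2_eq_square mult_ac)
qed

section \<open>Calculus of periodic functions\<close>

lemma partial_eqI: "(f has_derivative f') (at x) \<Longrightarrow> partial i f x = f' i"
  unfolding partial_def by (metis frechet_derivative_at)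

lemma has_derivative_frechet:
  "f differentiable (at x) \<Longrightarrow> (f has_derivative frechet_derivative f (at x)) (at x)"
  by (simp add: frechet_derivative_works)

lemma partial_add:
  assumes "f differentiable at x" "g differentiable at x"
  shows "partial i (\<lambda>x. f x + g x) x = partial i f x + partial i g x"
  using partial_eqI[OF has_derivative_add[OF assms[THEN has_derivative_frechet]]]
  by (simp add: partial_def)

lemma partial_mult:
  assumes "f differentiable at x" "g differentiable at x"
  shows "partial i (\<lambda>x. f x * g x) x = f x * partial i g x + partial i f x * g x"
  using partial_eqI[OF has_derivative_mult[OF assms[THEN has_derivative_frechet]]]
  by (simp add: partial_def)

lemma C_diff_differentiable: "C_diff (Suc k) f \<Longrightarrow> f differentiable at x"
  by (simp add: differentiable_on_def)

lemma C_diff_partial: "C_diff (Suc k) f \<Longrightarrow> i \<in> Basis \<Longrightarrow> C_diff k (partial i f)"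
  by simp

lemma C_diff_Suc_imp: "C_diff (Suc k) f \<Longrightarrow> C_diff k f"
proof (induction k arbitrary: f)
  case 0
  then show ?case by (auto intro: differentiable_imp_continuous_on)
next
  case (Suc k)
  then show ?case by (metis C_diff.simps(2))
qed

lemma C_diff_le: "C_diff m f \<Longrightarrow> k \<le> m \<Longrightarrow> C_diff k f"
  by (induction m rule: nat_induct) (auto simp del: C_diff.simps(2) simp: le_Suc_eq dest: C_diff_Suc_imp)

lemma C_diff_continuous: "C_diff k f \<Longrightarrow> continuous_on S f"
  using C_diff_le[of k f 0] by (auto intro: continuous_on_subset)

lemma C_diff_add: "C_diff k f \<Longrightarrow> C_diff k g \<Longrightarrow> C_diff k (\<lambda>x. f x + g x)"
proof (induction k arbitrary: f g)
  case 0
  then show ?case by (auto intro: continuous_intros)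
next
  case (Suc k)
  have "partial i (\<lambda>x. f x + g x) = (\<lambda>x. partial i f x + partial i g x)" for i
    by (intro ext partial_add Suc.prems[THEN C_diff_differentiable])
  then show ?case using Suc by (auto intro: differentiable_on_add)
qed

lemma C_diff_mult: "C_diff k f \<Longrightarrow> C_diff k g \<Longrightarrow> C_diff k (\<lambda>x. f x * g x)"
proof (induction k arbitrary: f g)
  case 0
  then show ?case by (auto intro: continuous_intros)
next
  case (Suc k)
  have "partial i (\<lambda>x. f x * g x) = (\<lambda>x. f x * partial i g x + partial i f x * g x)" for i
    by (intro ext partial_mult Suc.prems[THEN C_diff_differentiable])
  moreover have "C_diff k (\<lambda>x. f x * partial i g x + partial i f x * g x)" if "i \<in> Basis" for i
    using Suc that by (intro C_diff_add Suc.IH C_diff_partial C_diff_Suc_imp[of k])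
  ultimately show ?case using Suc.prems by (auto intro: differentiable_on_mult)
qed

lemma C_diff_const: "C_diff k (\<lambda>x. c)"
proof (induction k arbitrary: c)
  case (Suc k)
  have "partial i (\<lambda>x. c) = (\<lambda>x. 0)" for i :: 'a
    by (simp add: partial_def fun_eq_iff)
  then show ?case using Suc by simp
qed simp

lemma C_diff_cmult: "C_diff k f \<Longrightarrow> C_diff k (\<lambda>x. c * f x)"
  by (intro C_diff_mult C_diff_const)

lemma C_diff_sum: "(\<And>j. j \<in> J \<Longrightarrow> C_diff k (f j)) \<Longrightarrow> C_diff k (\<lambda>x. \<Sum>j\<in>J. f j x)"
  by (induction J rule: infinite_finite_induct) (auto intro: C_diff_add C_diff_const simp del: C_diff.simps)

lemma partial_sum_cmult:
  assumes "\<And>j. j \<in> J \<Longrightarrow> f j differentiable at x"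
  shows "partial i (\<lambda>x. \<Sum>j\<in>J. c j * f j x) x = (\<Sum>j\<in>J. c j * partial i (f j) x)"
  using partial_eqI[OF has_derivative_sum[OF has_derivative_mult_right[OF has_derivative_frechet[OF assms]]]]
  by (simp add: partial_def)

lemma box_periodicD: "box_periodic a b f \<Longrightarrow> i \<in> Basis \<Longrightarrow> f (x + ((b - a) \<bullet> i) *\<^sub>R i) = f x"
  by (simp add: box_periodic_def)

lemma box_periodic_add:
  "box_periodic a b f \<Longrightarrow> box_periodic a b g \<Longrightarrow> box_periodic a b (\<lambda>x. f x + g x)"
  by (simp add: box_periodic_def)

lemma box_periodic_mult:
  "box_periodic a b f \<Longrightarrow> box_periodic a b g \<Longrightarrow> box_periodic a b (\<lambda>x. f x * g x)"
  by (simp add: box_periodic_def)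

lemma box_periodic_cmult: "box_periodic a b f \<Longrightarrow> box_periodic a b (\<lambda>x. c * f x)"
  by (simp add: box_periodic_def)

lemma box_periodic_sum:
  "(\<And>j. j \<in> J \<Longrightarrow> box_periodic a b (f j)) \<Longrightarrow> box_periodic a b (\<lambda>x. \<Sum>j\<in>J. f j x)"
  by (simp add: box_periodic_def)

lemma box_periodic_partial:
  assumes "box_periodic a b f" "\<And>x. f differentiable at x"
  shows "box_periodic a b (partial i f)"
  unfolding box_periodic_def
proof (intro ballI allI)
  fix k x assume k: "k \<in> (Basis :: 'a set)"
  define v where "v = ((b - a) \<bullet> k) *\<^sub>R k"
  have "((\<lambda>y. f (y + v)) has_derivative (\<lambda>h. frechet_derivative f (at (x + v)) h)) (at x)"
    by (rule has_derivative_compose[OF _ has_derivative_frechet[OF assms(2)], of "\<lambda>y. y + v" "\<lambda>h. h"])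
      (auto intro!: derivative_eq_intros)
  moreover have "(\<lambda>y. f (y + v)) = f"
    using box_periodicD[OF assms(1) k] by (simp add: v_def)
  ultimately show "partial i f (x + ((b - a) \<bullet> k) *\<^sub>R k) = partial i f x"
    using partial_eqI[of f] unfolding v_def[symmetric] by (auto simp: partial_def)
qed

text \<open>
  The hyperplane through the face \<open>x \<bullet> i = b \<bullet> i\<close> cuts the translated box into a part of the original box and
  the translate by one period of what is left of the original box.
\<close>

lemma integral_periodic_shift:
  fixes f :: "'a::euclidean_space \<Rightarrow> real"
  assumes per: "box_periodic a b f" and cont: "continuous_on UNIV f"
    and i: "i \<in> Basis" and t: "0 \<le> t" "t \<le> (b - a) \<bullet> i"
    and box: "\<forall>k\<in>Basis. a \<bullet> k < b \<bullet> k"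
  shows "integral (cbox a b) (\<lambda>x. f (x + t *\<^sub>R i)) = integral (cbox a b) f"
proof -
  define v where "v = ((b - a) \<bullet> i) *\<^sub>R i"
  define A where "A = cbox a b \<inter> {x. x \<bullet> i \<le> a \<bullet> i + t}"
  define B where "B = cbox (a + t *\<^sub>R i) (b + t *\<^sub>R i)"
  have int: "f integrable_on cbox u w" for u w
    using cont by (auto intro: integrable_continuous continuous_on_subset)
  have coord_i: "(x + s *\<^sub>R i) \<bullet> i = x \<bullet> i + s" for x s
    using i by (simp add: inner_add_left)
  have coord_other: "(x + s *\<^sub>R i) \<bullet> k = x \<bullet> k" if "k \<in> Basis - {i}" for x s k
    using that i by (auto simp: inner_add_left inner_Basis)
  have mem: "x \<in> cbox u w \<longleftrightarrow> (u \<bullet> i \<le> x \<bullet> i \<and> x \<bullet> i \<le> w \<bullet> i) \<and>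
      (\<forall>k\<in>Basis - {i}. u \<bullet> k \<le> x \<bullet> k \<and> x \<bullet> k \<le> w \<bullet> k)" for x u w
    unfolding mem_box using i by blast
  have low: "B \<inter> {x. x \<bullet> i \<le> b \<bullet> i} = cbox a b \<inter> {x. x \<bullet> i \<ge> a \<bullet> i + t}"
    using t by (auto simp: B_def mem coord_i coord_other)
  have "x \<in> B \<inter> {x. x \<bullet> i \<ge> b \<bullet> i} \<longleftrightarrow> x + (- ((b - a) \<bullet> i)) *\<^sub>R i \<in> A" for x
    using t unfolding A_def B_def Int_iff mem mem_Collect_eq coord_i
    by (auto simp: coord_other inner_diff_left simp del: scaleR_minus_left add_uminus_conv_diff)
  moreover have "x \<in> (\<lambda>x. x + v) ` A \<longleftrightarrow> x + (- ((b - a) \<bullet> i)) *\<^sub>R i \<in> A" for x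
    by (force simp: v_def image_iff)
  ultimately have high: "B \<inter> {x. x \<bullet> i \<ge> b \<bullet> i} = (\<lambda>x. x + v) ` A"
    by blast
  obtain u w where A: "A = cbox u w"
    using interval_split(1)[OF i] unfolding A_def by blast
  have "integral ((\<lambda>x. x + v) ` A) f = integral (cbox (u + v) (w + v)) f"
    using cbox_translation[of v u w] by (simp add: A add.commute)
  also have "\<dots> = integral A (f \<circ> ((+) v))"
    by (simp add: A integral_shift_cbox_plus)
  also have "f \<circ> ((+) v) = f"
    using box_periodicD[OF per i] by (simp add: v_def fun_eq_iff add.commute)
  finally have A_shift: "integral ((\<lambda>x. x + v) ` A) f = integral A f" .
  have "integral (cbox a b) (\<lambda>x. f (x + t *\<^sub>R i)) = integral B f"
    using integral_shift_cbox_plus[of a b f "t *\<^sub>R i"] by (simp add: B_def o_def add.commute)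
  also have "\<dots> = integral (B \<inter> {x. x \<bullet> i \<le> b \<bullet> i}) f + integral (B \<inter> {x. x \<bullet> i \<ge> b \<bullet> i}) f"
    unfolding B_def by (rule integral_split[OF int i])
  also have "\<dots> = integral A f + integral (cbox a b \<inter> {x. x \<bullet> i \<ge> a \<bullet> i + t}) f"
    by (simp add: low high A_shift)
  also have "\<dots> = integral (cbox a b) f"
    unfolding A_def by (rule integral_split[OF int i, symmetric])
  finally show ?thesis .
qed

text \<open>
  The integral over the box of a translate of \<open>f\<close> along \<open>i\<close> does not depend on the translation, and its
  derivative with respect to the length of the translation, taken under the integral, is
  the integral of \<open>partial i f\<close>. This avoids an iterated integral in the coordinates.
\<close>

lemma integral_partial_periodic:
  fixes f :: "'a::euclidean_space \<Rightarrow> real"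
  assumes per: "box_periodic a b f" and C1: "C_diff 1 f"
    and i: "i \<in> Basis" and box: "\<forall>k\<in>Basis. a \<bullet> k < b \<bullet> k"
  shows "integral (cbox a b) (partial i f) = 0"
proof -
  define U where "U = {0 .. (b - a) \<bullet> i}"
  have L: "0 < (b - a) \<bullet> i" using box i by (simp add: inner_diff_left)
  have cont: "continuous_on S f" "continuous_on S (partial i f)" for S
    using C1 C_diff_continuous i by (auto simp: C_diff_continuous[of 0]
        intro: differentiable_imp_continuous_on continuous_on_subset)
  have "((\<lambda>t. integral (cbox a b) (\<lambda>x. f (x + t *\<^sub>R i))) has_vector_derivative
      integral (cbox a b) (\<lambda>x. partial i f (x + 0 *\<^sub>R i))) (at 0 within U)"
  proof (rule leibniz_rule_vector_derivative[where fx = "\<lambda>t x. partial i f (x + t *\<^sub>R i)"])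
    fix t x
    have "((\<lambda>t. f (x + t *\<^sub>R i)) has_derivative (\<lambda>h. frechet_derivative f (at (x + t *\<^sub>R i)) (h *\<^sub>R i))) (at t within U)"
      by (rule has_derivative_compose[OF _ has_derivative_frechet, of "\<lambda>t. x + t *\<^sub>R i"])
        (use C_diff_differentiable[of 0 f] C1 in \<open>auto intro!: derivative_eq_intros\<close>)
    moreover have "frechet_derivative f (at (x + t *\<^sub>R i)) (h *\<^sub>R i) = h *\<^sub>R partial i f (x + t *\<^sub>R i)" for h
      unfolding partial_def
      by (rule linear_scale[OF linear_frechet_derivative]) (use C_diff_differentiable[of 0 f] C1 in auto)
    ultimately show "((\<lambda>t. f (x + t *\<^sub>R i)) has_vector_derivative partial i f (x + t *\<^sub>R i)) (at t within U)"
      by (simp add: has_vector_derivative_def)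
  next
    show "(\<lambda>x. f (x + t *\<^sub>R i)) integrable_on cbox a b" for t
      by (intro integrable_continuous continuous_on_compose2[OF cont(1)] continuous_intros) auto
    show "continuous_on (U \<times> cbox a b) (\<lambda>(t, x). partial i f (x + t *\<^sub>R i))"
      unfolding split_beta
      by (intro continuous_on_compose2[OF cont(2)] continuous_intros) auto
  qed (use L in \<open>auto simp: U_def\<close>)
  moreover have "((\<lambda>t. integral (cbox a b) (\<lambda>x. f (x + t *\<^sub>R i))) has_vector_derivative 0) (at 0 within U)"
    by (rule has_vector_derivative_transform[OF _ _ has_vector_derivative_const[of "integral (cbox a b) f"]])
      (use L integral_periodic_shift[OF per cont(1) i _ _ box] in \<open>auto simp: U_def\<close>)
  ultimately have "integral (cbox a b) (\<lambda>x. partial i f (x + 0 *\<^sub>R i)) = 0"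
    by (rule vector_derivative_unique_within[rotated]) (use L in \<open>simp add: U_def trivial_limit_within islimpt_Icc\<close>)
  then show ?thesis by simp
qed

lemma laplacian_eq: "laplacian f x = (\<Sum>i\<in>Basis. partial i (partial i f) x)"
proof -
  have "(\<lambda>y. grad f y \<bullet> i) = partial i f" if "i \<in> Basis" for i
    using that by (simp add: grad_def fun_eq_iff inner_sum_left inner_Basis if_distrib sum.delta cong: if_cong)
  then show ?thesis by (simp add: laplacian_def dvg_def)
qed

lemma C_diff_laplacian: "C_diff (Suc (Suc k)) f \<Longrightarrow> C_diff k (laplacian f)"
  unfolding laplacian_eq[abs_def] by (intro C_diff_sum) simp

lemma box_periodic_laplacian:
  assumes "box_periodic a b f" "C_diff (Suc (Suc k)) f"
  shows "box_periodic a b (laplacian f)"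
  unfolding laplacian_eq[abs_def]
  using assms by (intro box_periodic_sum box_periodic_partial)
    (auto intro: C_diff_differentiable[OF C_diff_partial] C_diff_differentiable simp del: C_diff.simps)

lemma laplacian_sum_cmult:
  assumes "\<And>j. j \<in> J \<Longrightarrow> C_diff (Suc (Suc k)) (f j)"
  shows "laplacian (\<lambda>x. \<Sum>j\<in>J. c j * f j x) x = (\<Sum>j\<in>J. c j * laplacian (f j) x)"
proof -
  have "partial i (\<lambda>x. \<Sum>j\<in>J. c j * f j x) = (\<lambda>x. \<Sum>j\<in>J. c j * partial i (f j) x)" for i
    by (intro ext partial_sum_cmult C_diff_differentiable[OF assms])
  moreover have "partial i (\<lambda>x. \<Sum>j\<in>J. c j * partial i (f j) x) x = (\<Sum>j\<in>J. c j * partial i (partial i (f j)) x)"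
    if "i \<in> Basis" for i
    using that by (intro partial_sum_cmult C_diff_differentiable[OF C_diff_partial[OF assms]])
  ultimately show ?thesis
    by (simp add: laplacian_eq sum_distrib_left sum.swap[of _ J])
qed

lemma L2_inner_commute: "L2_inner a b f g = L2_inner a b g f"
  by (simp add: L2_inner_def mult.commute)

lemma L2_inner_sum_left:
  assumes "finite J" "\<And>j. j \<in> J \<Longrightarrow> continuous_on (cbox a b) (f j)" "continuous_on (cbox a b) g"
  shows "L2_inner a b (\<lambda>x. \<Sum>j\<in>J. c j * f j x) g = (\<Sum>j\<in>J. c j * L2_inner a b (f j) g)"
proof -
  have "L2_inner a b (\<lambda>x. \<Sum>j\<in>J. c j * f j x) g = integral (cbox a b) (\<lambda>x. \<Sum>j\<in>J. c j * (f j x * g x))"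
    by (simp add: L2_inner_def sum_distrib_right mult.assoc)
  also have "\<dots> = (\<Sum>j\<in>J. integral (cbox a b) (\<lambda>x. c j * (f j x * g x)))"
    using assms by (intro integral_sum integrable_continuous continuous_intros) auto
  finally show ?thesis by (simp add: L2_inner_def)
qed

lemma green_identity:
  fixes u v :: "'a::euclidean_space \<Rightarrow> real"
  assumes "box_periodic a b u" "box_periodic a b v" "C_diff 2 u" "C_diff 1 v"
    and box: "\<forall>k\<in>Basis. a \<bullet> k < b \<bullet> k"
  shows "L2_inner a b (laplacian u) v = - (\<Sum>i\<in>Basis. L2_inner a b (partial i u) (partial i v))"
proof -
  have u: "C_diff (Suc (Suc 0)) u" and v: "C_diff (Suc 0) v"
    using assms by (simp_all only: numeral_2_eq_2 One_nat_def)
  have parts: "L2_inner a b (partial i (partial i u)) v + L2_inner a b (partial i u) (partial i v) = 0"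
    if i: "i \<in> Basis" for i
  proof -
    have ui: "C_diff (Suc 0) (partial i u)" using C_diff_partial[OF u i] .
    have eq: "partial i (\<lambda>x. partial i u x * v x)
        = (\<lambda>x. partial i u x * partial i v x + partial i (partial i u) x * v x)"
      by (intro ext partial_mult C_diff_differentiable[OF ui] C_diff_differentiable[OF v])
    have "integral (cbox a b) (partial i (\<lambda>x. partial i u x * v x)) = 0"
      using assms(1,2) ui v i box
      by (intro integral_partial_periodic box_periodic_mult box_periodic_partial)
        (auto intro: C_diff_mult C_diff_differentiable[OF u] simp del: C_diff.simps simp: One_nat_def)
    moreover have "integral (cbox a b) (\<lambda>x. partial i u x * partial i v x + partial i (partial i u) x * v x)
      = integral (cbox a b) (\<lambda>x. partial i u x * partial i v x)
        + integral (cbox a b) (\<lambda>x. partial i (partial i u) x * v x)"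
      using C_diff_continuous[OF ui] C_diff_continuous[OF v] C_diff_continuous[OF C_diff_partial[OF ui i]]
        C_diff_continuous[OF C_diff_partial[OF v i]]
      by (intro integral_add integrable_continuous continuous_intros) auto
    ultimately show ?thesis unfolding eq by (simp add: L2_inner_def)
  qed
  have "L2_inner a b (laplacian u) v = (\<Sum>i\<in>Basis. L2_inner a b (partial i (partial i u)) v)"
    unfolding laplacian_eq[abs_def]
    using L2_inner_sum_left[of Basis a b "\<lambda>i. partial i (partial i u)" v "\<lambda>_. 1"]
      C_diff_continuous[OF C_diff_partial[OF C_diff_partial[OF u]]] C_diff_continuous[OF v] by simp
  also have "\<dots> = (\<Sum>i\<in>Basis. - L2_inner a b (partial i u) (partial i v))"
    using parts by (intro sum.cong refl) (simp add: eq_neg_iff_add_eq_0)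
  finally show ?thesis by (simp add: sum_negf)
qed

lemma laplacian_symmetric:
  fixes u v :: "'a::euclidean_space \<Rightarrow> real"
  assumes "box_periodic a b u" "box_periodic a b v" "C_diff 2 u" "C_diff 2 v"
    and box: "\<forall>k\<in>Basis. a \<bullet> k < b \<bullet> k"
  shows "L2_inner a b (laplacian u) v = L2_inner a b u (laplacian v)"
proof -
  have "C_diff 1 u" "C_diff 1 v" using assms C_diff_le[of 2 _ 1] by auto
  then show ?thesis
    using assms green_identity[of a b u v] green_identity[of a b v u]
    by (simp add: L2_inner_commute)
qed

lemma laplacian_lin:
  assumes "C_diff (Suc (Suc k)) u" "C_diff (Suc (Suc k)) v"
  shows "laplacian (\<lambda>x. p * u x + q * v x) = (\<lambda>x. p * laplacian u x + q * laplacian v x)"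
proof
  fix x
  show "laplacian (\<lambda>x. p * u x + q * v x) x = p * laplacian u x + q * laplacian v x"
    using laplacian_sum_cmult[of UNIV k "\<lambda>j. if j then u else v" "\<lambda>j. if j then p else q" x] assms
    by (simp add: UNIV_bool add.commute)
qed

section \<open>The energy balance\<close>

lemma regular_C_diff_2: "C_diff (reg_order M) u \<Longrightarrow> C_diff (Suc (Suc 0)) u"
  by (erule C_diff_le) (cases M; simp)

lemma regular_C_diff_4: "C_diff (reg_order (MBE w)) u \<Longrightarrow> C_diff (Suc (Suc (Suc (Suc 0)))) u"
  by (erule C_diff_le) simp

lemma L_op_lin:
  assumes "C_diff (reg_order M) u" "C_diff (reg_order M) v"
  shows "L_op M \<epsilon> (\<lambda>x. p * u x + q * v x) = (\<lambda>x. p * L_op M \<epsilon> u x + q * L_op M \<epsilon> v x)"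
proof -
  have two: "C_diff (Suc (Suc 0)) u" "C_diff (Suc (Suc 0)) v"
    using assms regular_C_diff_2 by blast+
  show ?thesis
  proof (cases M)
    case (MBE w)
    have four: "C_diff (Suc (Suc (Suc (Suc 0)))) u" "C_diff (Suc (Suc (Suc (Suc 0)))) v"
      using assms MBE regular_C_diff_4 by blast+
    show ?thesis
      by (simp add: MBE laplacian_lin[OF two] laplacian_lin[OF four[THEN C_diff_laplacian]]
          algebra_simps)
  qed (simp_all add: laplacian_lin[OF two] algebra_simps fun_eq_iff)
qed

lemma L_op_continuous:
  assumes "C_diff (reg_order M) u"
  shows "continuous_on S (L_op M \<epsilon> u)"
proof -
  have two: "C_diff (Suc (Suc 0)) u"
    using assms regular_C_diff_2 by blast+
  show ?thesis
  proof (cases M)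
    case (MBE w)
    have four: "C_diff (Suc (Suc (Suc (Suc 0)))) u"
      using assms MBE regular_C_diff_4 by blast+
    show ?thesis
      using C_diff_continuous[OF C_diff_laplacian[OF C_diff_laplacian[OF four]]] MBE
      by (auto intro: continuous_intros)
  qed (use C_diff_continuous[OF C_diff_laplacian[OF two]] in \<open>auto intro!: continuous_intros\<close>)
qed

lemma L2_inner_cmult_left: "L2_inner a b (\<lambda>x. c * f x) g = c * L2_inner a b f g"
  by (simp add: L2_inner_def mult.assoc)

lemma L_op_symmetric:
  assumes "box_periodic a b u" "box_periodic a b v" "C_diff (reg_order M) u" "C_diff (reg_order M) v"
    and box: "\<forall>k\<in>Basis. a \<bullet> k < b \<bullet> k"
  shows "L2_inner a b (L_op M \<epsilon> u) v = L2_inner a b (L_op M \<epsilon> v) u"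
proof -
  have two: "C_diff 2 u" "C_diff 2 v"
    using assms(3,4)[THEN regular_C_diff_2] unfolding numeral_2_eq_2 .
  have *: "L2_inner a b (laplacian u) v = L2_inner a b (laplacian v) u"
    using laplacian_symmetric[OF assms(1,2) two box] by (simp add: L2_inner_commute)
  show ?thesis
  proof (cases M)
    case (MBE w)
    have four: "C_diff (Suc (Suc 2)) u" "C_diff (Suc (Suc 2)) v"
      using assms MBE regular_C_diff_4 unfolding numeral_2_eq_2 by blast+
    have lap: "C_diff 2 (laplacian u)" "C_diff 2 (laplacian v)"
        "box_periodic a b (laplacian u)" "box_periodic a b (laplacian v)"
      using four[THEN C_diff_laplacian] box_periodic_laplacian[OF assms(1) four(1)]
        box_periodic_laplacian[OF assms(2) four(2)] by blast+
    have "L2_inner a b (laplacian (laplacian u)) v = L2_inner a b (laplacian u) (laplacian v)"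
      using laplacian_symmetric[OF lap(3) assms(2) lap(1) two(2) box] .
    moreover have "L2_inner a b (laplacian (laplacian v)) u = L2_inner a b (laplacian v) (laplacian u)"
      using laplacian_symmetric[OF lap(4) assms(1) lap(2) two(1) box] .
    ultimately show ?thesis
      using MBE by (simp add: L2_inner_cmult_left L2_inner_commute)
  qed (use * L2_inner_cmult_left[of a b "- \<epsilon>\<^sup>2"] in simp_all)
qed

lemma L2_inner_add_left:
  assumes "continuous_on (cbox a b) f" "continuous_on (cbox a b) g" "continuous_on (cbox a b) h"
  shows "L2_inner a b (\<lambda>x. f x + g x) h = L2_inner a b f h + L2_inner a b g h"
  unfolding L2_inner_def distrib_right
  using assms by (intro integral_add integrable_continuous continuous_intros)

text \<open>
  The quadratic part of the increment is \<open>\<langle>L m, v - u\<rangle>\<close> with \<open>m\<close> the mean of \<open>u\<close> and \<open>v\<close>, by symmetry of \<open>L\<close>;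
  the part from \<open>r\<close> is \<open>(r' + r) * (r' - r)\<close>, which the equation for \<open>r\<close> identifies with the
  nonlinear term of \<open>\<mu>\<close> tested with \<open>v - u\<close>. That term as a whole is continuous as the difference of \<open>\<mu>\<close> and the
  linear term, which makes its product with \<open>v - u\<close> integrable.
\<close>

lemma energy_increment:
  fixes u v \<mu> :: "'a::euclidean_space \<Rightarrow> real"
  assumes "box_periodic a b u" "box_periodic a b v" "C_diff (reg_order M) u" "C_diff (reg_order M) v"
    and box: "\<forall>k\<in>Basis. a \<bullet> k < b \<bullet> k"
    and cont: "continuous_on (cbox a b) \<mu>"
    and \<mu>: "\<And>x. \<mu> x = L_op M \<epsilon> (\<lambda>x. 1 / 2 * v x + 1 / 2 * u x) x + 1 / 2 * (r' + r) / s * \<delta> x"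
    and r: "r' - r = 1 / (2 * s) * L2_inner a b \<delta> (\<lambda>x. v x - u x)"
  shows "(1 / 2 * L2_inner a b (L_op M \<epsilon> v) v + r'\<^sup>2) - (1 / 2 * L2_inner a b (L_op M \<epsilon> u) u + r\<^sup>2)
    = L2_inner a b \<mu> (\<lambda>x. v x - u x)"
proof -
  let ?L = "L_op M \<epsilon>"
  define m where "m x = 1 / 2 * ?L v x + 1 / 2 * ?L u x" for x
  define w where "w x = 1 * v x + (- 1) * u x" for x
  have cuv: "continuous_on (cbox a b) u" "continuous_on (cbox a b) v"
      "continuous_on (cbox a b) (?L u)" "continuous_on (cbox a b) (?L v)"
    using assms(3,4) C_diff_continuous L_op_continuous by blast+
  have cw: "continuous_on (cbox a b) w" and cm: "continuous_on (cbox a b) m"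
    unfolding w_def m_def by (intro continuous_intros cuv)+
  have w: "(\<lambda>x. v x - u x) = w" by (simp add: w_def fun_eq_iff)
  have \<mu>': "\<mu> x = m x + 1 / 2 * (r' + r) / s * \<delta> x" for x
    unfolding m_def by (rule \<mu>[unfolded L_op_lin[OF assms(4,3)]])
  have right: "L2_inner a b f w = L2_inner a b f v - L2_inner a b f u"
    if "continuous_on (cbox a b) f" for f
    using that cuv L2_inner_add_left[of a b "\<lambda>x. 1 * v x" "\<lambda>x. (- 1) * u x" f]
    unfolding w_def L2_inner_commute[of a b f] L2_inner_cmult_left
    by (simp add: L2_inner_cmult_left continuous_intros)
  have "L2_inner a b m w = 1 / 2 * L2_inner a b (?L v) w + 1 / 2 * L2_inner a b (?L u) w"
    unfolding m_def L2_inner_cmult_left[symmetric]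
    by (intro L2_inner_add_left continuous_intros cuv cw)
  also have "\<dots> = 1 / 2 * L2_inner a b (?L v) v - 1 / 2 * L2_inner a b (?L u) u"
    using L_op_symmetric[OF assms(1-4) box, of \<epsilon>] right[OF cuv(3)] right[OF cuv(4)]
    by (simp add: algebra_simps)
  finally have quad: "L2_inner a b m w = 1 / 2 * L2_inner a b (?L v) v - 1 / 2 * L2_inner a b (?L u) u" .
  have "r'\<^sup>2 - r\<^sup>2 = (r' + r) * (r' - r)"
    by (simp add: power2_eq_square algebra_simps)
  also have "\<dots> = 1 / 2 * (r' + r) / s * L2_inner a b \<delta> w"
    unfolding r w by simp
  also have "\<dots> = L2_inner a b (\<lambda>x. 1 / 2 * (r' + r) / s * \<delta> x) w"
    by (rule L2_inner_cmult_left[symmetric])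
  finally have sq: "r'\<^sup>2 - r\<^sup>2 = L2_inner a b (\<lambda>x. 1 / 2 * (r' + r) / s * \<delta> x) w" .
  have "continuous_on (cbox a b) (\<lambda>x. \<mu> x - m x)"
    by (intro continuous_intros cont cm)
  then have "continuous_on (cbox a b) (\<lambda>x. 1 / 2 * (r' + r) / s * \<delta> x)"
    by (simp add: \<mu>')
  then have "L2_inner a b \<mu> w = L2_inner a b m w + L2_inner a b (\<lambda>x. 1 / 2 * (r' + r) / s * \<delta> x) w"
    unfolding \<mu>'[abs_def] using cm cw by (intro L2_inner_add_left)
  then show ?thesis
    unfolding w quad sq[symmetric] by simp
qed

text \<open>
  A quadratic form that is nonnegative on real sequences is nonnegative on \<open>L\<^sup>2\<close>-valued ones: evaluate
  it at each point of the box and integrate.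
\<close>

lemma L2_form_nonneg:
  assumes form: "\<And>z :: nat \<Rightarrow> real. 0 \<le> (\<Sum>k\<le>n. d k * (\<Sum>j\<le>k. \<beta> (k - j) * (z j * z k)))"
    and cont: "\<And>j. j \<le> n \<Longrightarrow> continuous_on (cbox a b) (y j)"
  shows "0 \<le> (\<Sum>k\<le>n. d k * (\<Sum>j\<le>k. \<beta> (k - j) * L2_inner a b (y j) (y k)))"
proof -
  have int: "(\<lambda>x. \<Sum>j\<le>k. \<beta> (k - j) * (y j x * y k x)) integrable_on cbox a b" if "k \<le> n" for k
    using that cont by (intro integrable_continuous continuous_intros) auto
  have "integral (cbox a b) (\<lambda>x. \<Sum>j\<le>k. \<beta> (k - j) * (y j x * y k x))
      = (\<Sum>j\<le>k. \<beta> (k - j) * L2_inner a b (y j) (y k))" if "k \<le> n" for k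
    using that cont
    by (subst integral_sum) (auto simp: L2_inner_def intro!: integrable_continuous continuous_intros)
  then have "(\<Sum>k\<le>n. d k * (\<Sum>j\<le>k. \<beta> (k - j) * L2_inner a b (y j) (y k)))
      = (\<Sum>k\<le>n. integral (cbox a b) (\<lambda>x. d k * (\<Sum>j\<le>k. \<beta> (k - j) * (y j x * y k x))))"
    by (intro sum.cong refl) simp
  also have "\<dots> = integral (cbox a b) (\<lambda>x. \<Sum>k\<le>n. d k * (\<Sum>j\<le>k. \<beta> (k - j) * (y j x * y k x)))"
    using int by (subst integral_sum) (auto intro!: integrable_on_mult_right)
  also have "\<dots> \<ge> 0"
  proof (rule integral_nonneg)
    show "(\<lambda>x. \<Sum>k\<le>n. d k * (\<Sum>j\<le>k. \<beta> (k - j) * (y j x * y k x))) integrable_on cbox a b"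
      by (rule integrable_sum, simp, rule integrable_on_mult_right, rule int, simp)
  qed (rule form)
  finally show ?thesis .
qed

section \<open>Inverting the convolution for Cahn-Hilliard\<close>

text \<open>
  The forward substitution that solves the lower triangular Toeplitz system with entries \<open>\<beta> (k - j)\<close>.
\<close>

fun deconvolution :: "(nat \<Rightarrow> real) \<Rightarrow> (nat \<Rightarrow> real) \<Rightarrow> nat \<Rightarrow> real" where
  "deconvolution \<beta> f k = (f k - (\<Sum>j<k. \<beta> (k - j) * deconvolution \<beta> f j)) / \<beta> 0"

declare deconvolution.simps [simp del]

lemma convolution_deconvolution:
  assumes "\<beta> 0 \<noteq> 0"
  shows "(\<Sum>j\<le>k. \<beta> (k - j) * deconvolution \<beta> f j) = f k"
proof -
  have "\<beta> 0 * deconvolution \<beta> f k = f k - (\<Sum>j<k. \<beta> (k - j) * deconvolution \<beta> f j)"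
    using assms by (subst deconvolution.simps) simp
  then show ?thesis
    by (simp add: lessThan_Suc_atMost[symmetric])
qed

lemma convolution_inj:
  fixes g h :: "nat \<Rightarrow> real"
  assumes "\<beta> 0 \<noteq> 0"
    and "\<And>k. k \<le> n \<Longrightarrow> (\<Sum>j\<le>k. \<beta> (k - j) * g j) = (\<Sum>j\<le>k. \<beta> (k - j) * h j)"
    and "k \<le> n"
  shows "g k = h k"
  using assms(3)
proof (induction k rule: less_induct)
  case (less k)
  have "(\<Sum>j<k. \<beta> (k - j) * g j) = (\<Sum>j<k. \<beta> (k - j) * h j)"
    using less by (intro sum.cong refl) auto
  then show ?case
    using assms(1) assms(2)[OF less.prems] by (simp add: lessThan_Suc_atMost[symmetric])
qed

text \<open>
  Deconvolution acts pointwise by finite linear combinations, so it preserves regularity and periodicity.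
\<close>

lemma deconvolution_regular:
  assumes "\<And>j. j \<le> n \<Longrightarrow> box_periodic a b (f j) \<and> C_diff m (f j)" "k \<le> n"
  shows "box_periodic a b (\<lambda>x. deconvolution \<beta> (\<lambda>j. f j x) k) \<and>
    C_diff m (\<lambda>x. deconvolution \<beta> (\<lambda>j. f j x) k)"
  using assms(2)
proof (induction k rule: less_induct)
  case (less k)
  have "(\<lambda>x. deconvolution \<beta> (\<lambda>j. f j x) k)
     = (\<lambda>x. 1 / \<beta> 0 * (f k x + (\<Sum>j<k. - \<beta> (k - j) * deconvolution \<beta> (\<lambda>j. f j x) j)))"
    by (subst deconvolution.simps) (simp add: sum_negf)
  moreover have "box_periodic a b (\<lambda>x. deconvolution \<beta> (\<lambda>j. f j x) j) \<and>
      C_diff m (\<lambda>x. deconvolution \<beta> (\<lambda>j. f j x) j)" if "j < k" for j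
    using less that by simp
  ultimately show ?case
    using assms(1)[OF less.prems]
    by (simp only:) (intro conjI box_periodic_cmult box_periodic_add box_periodic_sum
        C_diff_cmult C_diff_add C_diff_sum; blast)
qed

lemma extrap_eq:
  "extrap \<phi>m \<phi> n = (\<lambda>x. 3 / 2 * \<phi> n x + (- 1 / 2) * (if n = 0 then \<phi>m else \<phi> (n - 1)) x)"
  by (simp add: extrap_def fun_eq_iff)

text \<open>
  For \<open>\<G> = \<Delta>\<close> the integration by parts moves a derivative onto \<open>\<mu>\<close>, so the regularity of \<open>\<mu>\<close> has to be read off
  from the formula for \<open>\<mu>\<close>; here the nonlinearity is a polynomial in the extrapolated value.
\<close>

lemma Cahn_Hilliard_potential_regular:
  fixes u e \<mu> :: "'a::euclidean_space \<Rightarrow> real"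
  assumes "box_periodic a b u" "C_diff 4 u" "box_periodic a b e" "C_diff 4 e"
    and "\<And>x. \<mu> x = L_op Cahn_Hilliard \<epsilon> u x + \<rho> * delta_E1 Cahn_Hilliard e x"
  shows "box_periodic a b \<mu> \<and> C_diff 2 \<mu>"
proof -
  have four: "C_diff (Suc (Suc 2)) u"
    using assms(2) by (rule C_diff_le) simp
  have "C_diff 2 e" using assms(4) C_diff_le[of 4 e 2] by simp
  moreover have "\<mu> = (\<lambda>x. (- \<epsilon>\<^sup>2) * laplacian u x + \<rho> * (e x * e x * e x + (- 1) * e x))"
    using assms(5) by (simp add: fun_eq_iff power3_eq_cube)
  ultimately show ?thesis
    using assms(1,3) C_diff_laplacian[OF four] box_periodic_laplacian[OF assms(1) four]
    by (simp only:) (intro conjI box_periodic_cmult box_periodic_add box_periodic_mult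
        C_diff_cmult C_diff_add C_diff_mult)
qed

section \<open>Energy bound and fractional energy law\<close>

theorem theorem3p1:
  fixes a b :: "'a::euclidean_space"
    and M :: model
    and \<alpha> \<gamma> \<epsilon> dt T C0 :: real
    and \<phi> \<mu> :: "nat \<Rightarrow> 'a \<Rightarrow> real"
    and \<phi>m :: "'a \<Rightarrow> real"
    and r :: "nat \<Rightarrow> real"
  assumes box: "\<forall>i\<in>Basis. a \<bullet> i < b \<bullet> i"
    and params: "0 < \<alpha>" "\<alpha> < 1" "0 < \<gamma>" "0 < \<epsilon>" "0 < dt" "0 < C0"
    and start: "box_periodic a b \<phi>m" "C_diff (reg_order M) \<phi>m"
    and iterates: "\<And>n. real n * dt \<le> T \<Longrightarrow> box_periodic a b (\<phi> n) \<and> C_diff (reg_order M) (\<phi> n)"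
    and sqrt_pos: "\<And>n. real (n + 1) * dt \<le> T \<Longrightarrow> 0 < E1 M a b (extrap \<phi>m \<phi> n) + C0"
    and scheme_phi: "\<And>n x. real (n + 1) * dt \<le> T \<Longrightarrow>
          frac_diff \<alpha> dt (\<lambda>k. \<phi> k x) n = \<gamma> * G_op M (\<mu> n) x"
    and scheme_mu: "\<And>n x. real (n + 1) * dt \<le> T \<Longrightarrow>
          \<mu> n x = L_op M \<epsilon> (mid_fun \<phi> n) x
            + mid r n / sqrt (E1 M a b (extrap \<phi>m \<phi> n) + C0) * delta_E1 M (extrap \<phi>m \<phi> n) x"
    and scheme_r: "\<And>n. real (n + 1) * dt \<le> T \<Longrightarrow>
          r (n + 1) - r n = 1 / (2 * sqrt (E1 M a b (extrap \<phi>m \<phi> n) + C0))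
            * L2_inner a b (delta_E1 M (extrap \<phi>m \<phi> n)) (\<lambda>x. \<phi> (n + 1) x - \<phi> n x)"
  shows "(\<forall>n. real (n + 1) * dt \<le> T \<longrightarrow>
            mod_energy M \<epsilon> a b \<phi> r (n + 1) \<le> mod_energy M \<epsilon> a b \<phi> r 0)
       \<and> (\<forall>n. real (n + 1) * dt \<le> T \<longrightarrow>
            frac_diff \<alpha> dt (mod_energy M \<epsilon> a b \<phi> r) n \<le> 0)"
proof -
  define \<beta> where "\<beta> = b_coeff \<alpha> dt"
  interpret log_convex_kernel \<beta> "\<lambda>m. dt powr (1 - \<alpha>) / Gamma (2 - \<alpha>) * L1_weight (1 - \<alpha>) m"
    unfolding \<beta>_def using log_convex_kernel_b_coeff params by simp
  have \<beta>0: "\<beta> 0 \<noteq> 0" using pos[of 0] c_eq[of 0] by auto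
  define E where "E = mod_energy M \<epsilon> a b \<phi> r"
  define D where "D k x = (\<phi> (Suc k) x - \<phi> k x) / dt" for k x
  have frac: "frac_diff \<alpha> dt (\<lambda>k. \<phi> k x) k = (\<Sum>j\<le>k. \<beta> (k - j) * D j x)" for k x
    by (simp add: frac_diff_def \<beta>_def D_def bdiff_def atLeast0AtMost)
  \<comment> \<open>Both claims are instances: \<open>d\<close> is constant for the first, \<open>d k = \<beta> (n - k)\<close> for the second.\<close>
  have weighted_rate: "(\<Sum>k\<le>n. d k * ((E (Suc k) - E k) / dt)) \<le> 0"
    if n: "real (n + 1) * dt \<le> T"
      and form: "\<And>z :: nat \<Rightarrow> real. 0 \<le> (\<Sum>k\<le>n. d k * (\<Sum>j\<le>k. \<beta> (k - j) * (z j * z k)))"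
    for n and d :: "nat \<Rightarrow> real"
  proof -
    have le: "real k * dt \<le> T" if "k \<le> Suc n" for k
    proof -
      have "real k * dt \<le> real (n + 1) * dt" using that params by (intro mult_right_mono) auto
      then show ?thesis using n by simp
    qed
    have le': "real (k + 1) * dt \<le> T" if "k \<le> n" for k
      using le[of "k + 1"] that by simp
    have reg: "box_periodic a b (\<phi> k)" "C_diff (reg_order M) (\<phi> k)" if "k \<le> Suc n" for k
      using iterates[OF le[OF that]] by auto
    have D_cont: "continuous_on (cbox a b) (D k)" if "k \<le> n" for k
      unfolding D_def using that params
      by (auto intro!: continuous_intros C_diff_continuous[OF reg(2)])
    have mid_eq: "mid_fun \<phi> k = (\<lambda>x. 1 / 2 * \<phi> (Suc k) x + 1 / 2 * \<phi> k x)" for k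
      by (simp add: mid_fun_def mid_def fun_eq_iff)
    have incr: "(E (Suc k) - E k) / dt = L2_inner a b (\<mu> k) (D k)"
      if k: "k \<le> n" and cont: "continuous_on (cbox a b) (\<mu> k)" for k
    proof -
      have "E (Suc k) - E k = L2_inner a b (\<mu> k) (\<lambda>x. \<phi> (Suc k) x - \<phi> k x)"
        unfolding E_def mod_energy_def
      proof (rule energy_increment[OF _ _ _ _ box cont])
        show "\<mu> k x = L_op M \<epsilon> (\<lambda>x. 1 / 2 * \<phi> (Suc k) x + 1 / 2 * \<phi> k x) x
            + 1 / 2 * (r (Suc k) + r k) / sqrt (E1 M a b (extrap \<phi>m \<phi> k) + C0)
              * delta_E1 M (extrap \<phi>m \<phi> k) x" for x
          using scheme_mu[OF le'[OF k], of x] by (simp add: mid_eq mid_def)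
        show "r (Suc k) - r k = 1 / (2 * sqrt (E1 M a b (extrap \<phi>m \<phi> k) + C0))
            * L2_inner a b (delta_E1 M (extrap \<phi>m \<phi> k)) (\<lambda>x. \<phi> (Suc k) x - \<phi> k x)"
          using scheme_r[OF le'[OF k]] by simp
      qed (use reg k in auto)
      also have "(\<lambda>x. \<phi> (Suc k) x - \<phi> k x) = (\<lambda>x. dt * D k x)"
        using params by (simp add: D_def)
      also have "L2_inner a b (\<mu> k) (\<lambda>x. dt * D k x) = dt * L2_inner a b (\<mu> k) (D k)"
        by (simp add: L2_inner_commute[of a b "\<mu> k"] L2_inner_cmult_left)
      finally show ?thesis using params by simp
    qed
    \<comment> \<open>The index set is a singleton for \<open>\<G> = - 1\<close> (with an arbitrary element) and the set of coordinate
      directions for \<open>\<G> = \<Delta>\<close>.\<close>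
    have "\<exists>(I :: 'a set) y. finite I \<and> (\<forall>i\<in>I. \<forall>j\<le>n. continuous_on (cbox a b) (y i j))
      \<and> (\<forall>k\<le>n. (E (Suc k) - E k) / dt
            = - (1 / \<gamma>) * (\<Sum>i\<in>I. \<Sum>j\<le>k. \<beta> (k - j) * L2_inner a b (y i j) (y i k)))"
    proof (cases "M = Cahn_Hilliard")
      case False
      have \<mu>: "\<mu> k = (\<lambda>x. - (1 / \<gamma>) * (\<Sum>j\<le>k. \<beta> (k - j) * D j x))" if "k \<le> n" for k
      proof
        fix x
        have "G_op M (\<mu> k) x = - \<mu> k x" using False by (cases M) auto
        then have "(\<Sum>j\<le>k. \<beta> (k - j) * D j x) = - \<gamma> * \<mu> k x"
          using scheme_phi[OF le'[OF that], of x] frac[of x k] by simp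
        then show "\<mu> k x = - (1 / \<gamma>) * (\<Sum>j\<le>k. \<beta> (k - j) * D j x)"
          using params by simp
      qed
      have "(E (Suc k) - E k) / dt = - (1 / \<gamma>) * (\<Sum>j\<le>k. \<beta> (k - j) * L2_inner a b (D j) (D k))"
        if k: "k \<le> n" for k
      proof -
        \<comment> \<open>The expression through the history also gives the continuity of \<open>\<mu> k\<close>.\<close>
        have "continuous_on (cbox a b) (\<mu> k)"
          unfolding \<mu>[OF k] using k D_cont by (intro continuous_intros) auto
        then have "(E (Suc k) - E k) / dt = L2_inner a b (\<mu> k) (D k)" by (rule incr[OF k])
        also have "\<dots> = - (1 / \<gamma>) * L2_inner a b (\<lambda>x. \<Sum>j\<le>k. \<beta> (k - j) * D j x) (D k)"
          unfolding \<mu>[OF k] by (rule L2_inner_cmult_left)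
        also have "L2_inner a b (\<lambda>x. \<Sum>j\<le>k. \<beta> (k - j) * D j x) (D k)
            = (\<Sum>j\<le>k. \<beta> (k - j) * L2_inner a b (D j) (D k))"
          using k D_cont by (intro L2_inner_sum_left) auto
        finally show ?thesis .
      qed
      then show ?thesis
        using D_cont by (intro exI[of _ "{0}"] exI[of _ "\<lambda>_. D"]) auto
    next
      case True
      have four: "C_diff 4 (\<phi> k)" if "k \<le> Suc n" for k
        using reg(2)[OF that] True by simp
      have \<mu>_reg: "box_periodic a b (\<mu> k) \<and> C_diff 2 (\<mu> k)" if k: "k \<le> n" for k
      proof (rule Cahn_Hilliard_potential_regular)
        show "box_periodic a b (mid_fun \<phi> k)" "C_diff 4 (mid_fun \<phi> k)"
          unfolding mid_eq using k
          by (intro box_periodic_add box_periodic_cmult C_diff_add C_diff_cmult reg(1) four; simp)+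
        show "box_periodic a b (extrap \<phi>m \<phi> k)" "C_diff 4 (extrap \<phi>m \<phi> k)"
          unfolding extrap_eq using k reg(1) four start True
          by (intro box_periodic_add box_periodic_cmult C_diff_add C_diff_cmult; simp)+
        show "\<mu> k x = L_op Cahn_Hilliard \<epsilon> (mid_fun \<phi> k) x
            + mid r k / sqrt (E1 M a b (extrap \<phi>m \<phi> k) + C0) * delta_E1 Cahn_Hilliard (extrap \<phi>m \<phi> k) x" for x
          using scheme_mu[OF le'[OF k], of x] True by simp
      qed
      \<comment> \<open>The function \<open>w k\<close> stands for an inverse Laplacian of \<open>D k\<close>.\<close>
      define w where "w k x = deconvolution \<beta> (\<lambda>j. \<gamma> * \<mu> j x) k" for k x
      have w_reg: "box_periodic a b (w k)" "C_diff 2 (w k)" if "k \<le> n" for k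
      proof -
        have "box_periodic a b (\<lambda>x. \<gamma> * \<mu> j x) \<and> C_diff 2 (\<lambda>x. \<gamma> * \<mu> j x)" if "j \<le> n" for j
          using \<mu>_reg[OF that] box_periodic_cmult C_diff_cmult by blast
        from deconvolution_regular[where f = "\<lambda>j x. \<gamma> * \<mu> j x" and \<beta> = \<beta>, OF this that]
        show "box_periodic a b (w k)" "C_diff 2 (w k)"
          unfolding w_def[abs_def] by blast+
      qed
      have two: "C_diff (Suc (Suc 0)) (w k)" "C_diff (Suc (Suc 0)) (\<mu> k)" if "k \<le> n" for k
        using w_reg(2)[OF that] \<mu>_reg[OF that] unfolding numeral_2_eq_2 by blast+
      have \<mu>: "\<mu> k = (\<lambda>x. \<Sum>j\<le>k. (\<beta> (k - j) / \<gamma>) * w j x)" for k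
      proof
        fix x
        have "(\<Sum>j\<le>k. \<beta> (k - j) * w j x) = \<gamma> * \<mu> k x"
          unfolding w_def using \<beta>0 by (rule convolution_deconvolution)
        then show "\<mu> k x = (\<Sum>j\<le>k. (\<beta> (k - j) / \<gamma>) * w j x)"
          using params by (simp add: sum_divide_distrib[symmetric])
      qed
      \<comment> \<open>Both sides have the same convolution with \<open>\<beta>\<close>, by the first equation of the scheme.\<close>
      have lap: "D k x = laplacian (w k) x" if "k \<le> n" for k x
      proof (rule convolution_inj[where \<beta> = \<beta> and n = n, OF \<beta>0 _ that])
        fix k assume k: "k \<le> n"
        have "(\<Sum>j\<le>k. \<beta> (k - j) * D j x) = \<gamma> * laplacian (\<mu> k) x"
          using scheme_phi[OF le'[OF k], of x] frac[of x k] True by simp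
        also have "laplacian (\<mu> k) x = (\<Sum>j\<le>k. (\<beta> (k - j) / \<gamma>) * laplacian (w j) x)"
          unfolding \<mu>[of k] using k by (intro laplacian_sum_cmult[of _ 0] two) auto
        finally show "(\<Sum>j\<le>k. \<beta> (k - j) * D j x) = (\<Sum>j\<le>k. \<beta> (k - j) * laplacian (w j) x)"
          using params by (simp add: sum_distrib_left)
      qed
      have pw_cont: "continuous_on (cbox a b) (partial i (w k))" if "k \<le> n" "i \<in> Basis" for k i
        using that by (intro C_diff_continuous[OF C_diff_partial[OF two(1)]])
      have "(E (Suc k) - E k) / dt = - (1 / \<gamma>) *
          (\<Sum>i\<in>Basis. \<Sum>j\<le>k. \<beta> (k - j) * L2_inner a b (partial i (w j)) (partial i (w k)))"
        if k: "k \<le> n" for k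
      proof -
        have part: "partial i (\<mu> k) = (\<lambda>x. \<Sum>j\<le>k. (\<beta> (k - j) / \<gamma>) * partial i (w j) x)" for i
          unfolding \<mu>[of k] using k
          by (intro ext partial_sum_cmult C_diff_differentiable[OF two(1)]) auto
        have "(E (Suc k) - E k) / dt = L2_inner a b (\<mu> k) (D k)"
          using incr[OF k] C_diff_continuous \<mu>_reg[OF k] by blast
        also have "D k = laplacian (w k)" using lap[OF k] by auto
        also have "L2_inner a b (\<mu> k) (laplacian (w k)) = L2_inner a b (laplacian (w k)) (\<mu> k)"
          by (rule L2_inner_commute)
        also have "\<dots> = - (\<Sum>i\<in>Basis. L2_inner a b (partial i (w k)) (partial i (\<mu> k)))"
          using w_reg[OF k] \<mu>_reg[OF k] C_diff_le[of 2 "\<mu> k" 1] box by (intro green_identity) auto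
        also have "(\<Sum>i\<in>Basis. L2_inner a b (partial i (w k)) (partial i (\<mu> k)))
            = (\<Sum>i\<in>Basis. \<Sum>j\<le>k. (\<beta> (k - j) / \<gamma>) * L2_inner a b (partial i (w j)) (partial i (w k)))"
        proof (intro sum.cong refl)
          fix i :: 'a assume "i \<in> Basis"
          then have "L2_inner a b (partial i (\<mu> k)) (partial i (w k))
              = (\<Sum>j\<le>k. (\<beta> (k - j) / \<gamma>) * L2_inner a b (partial i (w j)) (partial i (w k)))"
            unfolding part using k pw_cont by (intro L2_inner_sum_left) auto
          then show "L2_inner a b (partial i (w k)) (partial i (\<mu> k))
              = (\<Sum>j\<le>k. (\<beta> (k - j) / \<gamma>) * L2_inner a b (partial i (w j)) (partial i (w k)))"
            by (simp only: L2_inner_commute[of a b "partial i (w k)" "partial i (\<mu> k)"])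
        qed
        finally show ?thesis by (simp add: sum_divide_distrib[symmetric])
      qed
      then show ?thesis
        using pw_cont by (intro exI[of _ Basis] exI[of _ "\<lambda>i j. partial i (w j)"]) auto
    qed
    then obtain I :: "'a set" and y where I: "finite I"
        and y: "\<And>i j. i \<in> I \<Longrightarrow> j \<le> n \<Longrightarrow> continuous_on (cbox a b) (y i j)"
        and rate: "\<And>k. k \<le> n \<Longrightarrow> (E (Suc k) - E k) / dt
            = - (1 / \<gamma>) * (\<Sum>i\<in>I. \<Sum>j\<le>k. \<beta> (k - j) * L2_inner a b (y i j) (y i k))"
      by blast
    have "(\<Sum>k\<le>n. d k * ((E (Suc k) - E k) / dt))
        = (\<Sum>k\<le>n. d k * (- (1 / \<gamma>) * (\<Sum>i\<in>I. \<Sum>j\<le>k. \<beta> (k - j) * L2_inner a b (y i j) (y i k))))"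
      using rate by (intro sum.cong refl) simp
    also have "\<dots> = - (1 / \<gamma>) * (\<Sum>i\<in>I. \<Sum>k\<le>n. d k * (\<Sum>j\<le>k. \<beta> (k - j) * L2_inner a b (y i j) (y i k)))"
      by (subst sum.swap) (simp add: sum_distrib_left mult_ac sum_negf)
    also have "\<dots> \<le> 0"
      using params y by (intro mult_nonpos_nonneg sum_nonneg L2_form_nonneg form) auto
    finally show ?thesis .
  qed
  show ?thesis
  proof (intro conjI allI impI)
    fix n assume n: "real (n + 1) * dt \<le> T"
    have "(\<Sum>k\<le>n. 1 * ((E (Suc k) - E k) / dt)) \<le> 0"
      by (rule weighted_rate[OF n]) (use convolution_form_nonneg in simp)
    moreover have "(\<Sum>k\<le>n. E (Suc k) - E k) = E (n + 1) - E 0"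
      by (simp add: sum_telescope'' flip: lessThan_Suc_atMost sum_lessThan_telescope)
    ultimately have "(E (n + 1) - E 0) / dt \<le> 0"
      by (simp add: sum_divide_distrib[symmetric])
    then show "mod_energy M \<epsilon> a b \<phi> r (n + 1) \<le> mod_energy M \<epsilon> a b \<phi> r 0"
      using params by (simp add: E_def divide_le_0_iff)
    have "frac_diff \<alpha> dt E n = (\<Sum>k\<le>n. \<beta> (n - k) * ((E (Suc k) - E k) / dt))"
      by (simp add: frac_diff_def \<beta>_def bdiff_def atLeast0AtMost)
    also have "\<dots> \<le> 0"
      by (rule weighted_rate[OF n]) (rule double_convolution_form_nonneg)
    finally show "frac_diff \<alpha> dt (mod_energy M \<epsilon> a b \<phi> r) n \<le> 0"
      by (simp add: E_def)
  qed
qed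

end
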